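(* Let $B\subseteq\mathcal B(H)$ with $H$ finite-dimensional, and let $A\in\mathcal B(L^2(B))$ be self-adjoint with $m(A\otimes A)m^*=A$ and $(1\otimes\eta^*m)(1\otimes A\otimes1)(m^*\eta\otimes1)=A$. Let $e=\Psi_{0,1/2}(A)$ or $e=\Psi'_{1/2,0}(A)$, and let $V\subseteq H\otimes\overline H$ be the image of $e$ acting on $H\otimes\overline H$. Let $(e_j)$ be an orthonormal basis of $H$ and set $u_0=\sum_j e_j\otimes\overline{Q^{-1/2}(e_j)}$, $u_1=\sum_j Q^{-1/2}(e_j)\otimes\overline{e_j}$ in $H\otimes\overline H$. The following are equivalent: (1) $m(A\otimes1)m^*=0$ or, equivalently, $m(1\otimes A)m^*=0$; (2) $e(u_0)=0$ or, equivalently, $e(u_1)=0$; (3) $V$ is orthogonal to $u_0$ or, equivalently, to $u_1$; (4) $\mathsf m\big((\sigma_{-i/2}\otimes\mathrm{id})(e)\big)=0$, where $\mathsf m:B\otimes B^{\mathrm{op}}\to B$, $a\otimes b\mapsto ab$, is the multiplication map.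
   Context: $B$ is a finite-dimensional $C^*$-algebra, $\mathrm{Tr}$ the sum of the non-normalised traces of its matrix blocks, $\psi$ a faithful state on $B$, $Q\in B$ the positive invertible element with $\psi(a)=\mathrm{Tr}(Qa)$, and $\sigma_z(a)=Q^{iz}aQ^{-iz}$ for $z\in\mathbb C$, $a\in B$. Inner products are linear in the right variable and $\theta_{\xi,\eta}(\zeta)=(\xi|\zeta)\eta$. $L^2(B)$ is the GNS space of $\psi$ with GNS map $\Lambda$ (a linear bijection), $(\Lambda(a)|\Lambda(b))=\psi(a^*b)$; $m:L^2(B)\otimes L^2(B)\to L^2(B)$ is $m(\Lambda(a)\otimes\Lambda(b))=\Lambda(ab)$ with Hilbert space adjoint $m^*$; $\eta:\mathbb C\to L^2(B)$, $\lambda\mapsto\lambda\Lambda(1)$, with adjoint $\eta^*$. $B^{\mathrm{op}}$ is $B$ with reversed product. $\Psi_{0,1/2},\Psi'_{1/2,0}:\mathcal B(L^2(B))\to B\otimes B^{\mathrm{op}}$ are the linear bijections with $\Psi_{0,1/2}(\theta_{\Lambda(a),\Lambda(b)})=a^*\otimes\sigma_{i/2}(b)$ and $\Psi'_{1/2,0}(\theta_{\Lambda(a),\Lambda(b)})=\sigma_{i/2}(b)\otimes a^*$. For $A$ as in the claim, $e$ is an orthogonal projection. $B$ is a unital $*$-subalgebra of $\mathcal B(H)$. $\overline H$ is the conjugate Hilbert space; $x^\top(\overline\xi)=\overline{x^*\xi}$ for $x\in\mathcal B(H)$; $B\otimes B^{\mathrm{op}}$ acts on $H\otimes\overline H$ via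 $a\otimes b\mapsto a\otimes b^\top$. *)

theory Defs
  imports "HOL-Analysis.Analysis"
begin

text \<open>The finite-dimensional Hilbert space \<open>H\<close> is \<open>complex ^ 'n\<close> and \<open>\<B>(H)\<close> is
  \<open>complex ^ 'n ^ 'n\<close>; every inner product is linear in its right variable.\<close>

definition cinner :: "complex ^ 'n \<Rightarrow> complex ^ 'n \<Rightarrow> complex" where
  "cinner u v = (\<Sum>i\<in>UNIV. cnj (u $ i) * v $ i)"

definition cscale :: "complex \<Rightarrow> complex ^ 'n ^ 'm \<Rightarrow> complex ^ 'n ^ 'm" where
  "cscale c a = (\<chi> i j. c * a $ i $ j)"

definition cadj :: "complex ^ 'n ^ 'n \<Rightarrow> complex ^ 'n ^ 'n" where
  "cadj a = (\<chi> i j. cnj (a $ j $ i))"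

lemma cinner_cadj: "cinner (cadj a *v u) v = cinner u (a *v v)"
  unfolding cinner_def cadj_def matrix_vector_mult_def
  by (simp add: sum_distrib_left sum_distrib_right mult_ac)
     (subst sum.swap, simp add: mult_ac)

definition orthonormal_basis :: "('j::finite \<Rightarrow> complex ^ 'n) \<Rightarrow> bool" where
  "orthonormal_basis f \<longleftrightarrow>
     (\<forall>i j. cinner (f i) (f j) = (if i = j then 1 else 0)) \<and>
     (\<forall>v. \<exists>c. v = (\<Sum>j\<in>UNIV. c j *s f j))"

text \<open>The conjugate Hilbert space of \<open>complex ^ 'n\<close> is realised on \<open>complex ^ 'n\<close> itself, the
  vector \<open>\<xi>\<close> giving \<open>vbar \<xi>\<close>.  Under this identification the operator sending the conjugate of
  \<open>\<xi>\<close> to the conjugate of \<open>x\<^sup>* \<xi>\<close> is the transposed matrix.\<close>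

definition vbar :: "complex ^ 'n \<Rightarrow> complex ^ 'n" where
  "vbar v = (\<chi> i. cnj (v $ i))"

lemma cinner_vbar: "cinner (vbar u) (vbar v) = cinner v u"
  by (simp add: cinner_def vbar_def mult.commute)

lemma transpose_vbar: "transpose x *v vbar v = vbar (cadj x *v v)"
  by (simp add: vec_eq_iff vbar_def cadj_def transpose_def matrix_vector_mult_def)

definition vtensor :: "complex ^ 'n \<Rightarrow> complex ^ 'm \<Rightarrow> complex ^ ('n \<times> 'm)" where
  "vtensor u v = (\<chi> p. u $ fst p * v $ snd p)"

definition unital_star_subalgebra :: "(complex ^ 'n ^ 'n) set \<Rightarrow> bool" where
  "unital_star_subalgebra B \<longleftrightarrow>
     mat 1 \<in> B \<and>
     (\<forall>a\<in>B. \<forall>b\<in>B. a + b \<in> B \<and> a ** b \<in> B) \<and>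
     (\<forall>c. \<forall>a\<in>B. cscale c a \<in> B) \<and>
     (\<forall>a\<in>B. cadj a \<in> B)"

definition linear_on_alg ::
    "(complex ^ 'n ^ 'n) set \<Rightarrow> (complex ^ 'n ^ 'n \<Rightarrow> complex) \<Rightarrow> bool" where
  "linear_on_alg B \<phi> \<longleftrightarrow>
     (\<forall>a\<in>B. \<forall>b\<in>B. \<phi> (a + b) = \<phi> a + \<phi> b) \<and> (\<forall>c. \<forall>a\<in>B. \<phi> (cscale c a) = c * \<phi> a)"

text \<open>An element of the direct sum of the full matrix algebras of sizes \<open>d 0, \<dots>, d (r - 1)\<close> is a
  family \<open>x\<close> with \<open>x k i j\<close> the \<open>(i, j)\<close> entry of the \<open>k\<close>-th block.\<close>

definition block_families :: "nat \<Rightarrow> (nat \<Rightarrow> nat) \<Rightarrow> (nat \<Rightarrow> nat \<Rightarrow> nat \<Rightarrow> complex) set" where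
  "block_families r d = {x. \<forall>k i j. x k i j \<noteq> 0 \<longrightarrow> k < r \<and> i < d k \<and> j < d k}"

definition block_star_iso ::
    "(complex ^ 'n ^ 'n) set \<Rightarrow> nat \<Rightarrow> (nat \<Rightarrow> nat) \<Rightarrow>
      (complex ^ 'n ^ 'n \<Rightarrow> nat \<Rightarrow> nat \<Rightarrow> nat \<Rightarrow> complex) \<Rightarrow> bool" where
  "block_star_iso B r d \<pi> \<longleftrightarrow>
     bij_betw \<pi> B (block_families r d) \<and>
     (\<forall>a\<in>B. \<forall>b\<in>B. \<forall>k i j. \<pi> (a + b) k i j = \<pi> a k i j + \<pi> b k i j) \<and>
     (\<forall>c. \<forall>a\<in>B. \<forall>k i j. \<pi> (cscale c a) k i j = c * \<pi> a k i j) \<and>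
     (\<forall>a\<in>B. \<forall>b\<in>B. \<forall>k i j. \<pi> (a ** b) k i j = (\<Sum>l<d k. \<pi> a k i l * \<pi> b k l j)) \<and>
     (\<forall>a\<in>B. \<forall>k i j. \<pi> (cadj a) k i j = cnj (\<pi> a k j i))"

text \<open>\<open>block_trace B Tr\<close>: on \<open>B\<close>, \<open>Tr\<close> is the sum of the non-normalised traces of the matrix blocks
  of \<open>B\<close>.  This is intrinsic to \<open>B\<close>; in general it is not the trace of \<open>\<B>(H)\<close> restricted to \<open>B\<close>.\<close>

definition block_trace ::
    "(complex ^ 'n ^ 'n) set \<Rightarrow> (complex ^ 'n ^ 'n \<Rightarrow> complex) \<Rightarrow> bool" where
  "block_trace B Tr \<longleftrightarrow>
     (\<exists>r d \<pi>. block_star_iso B r d \<pi> \<and> (\<forall>a\<in>B. Tr a = (\<Sum>k<r. \<Sum>i<d k. \<pi> a k i i)))"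

definition faithful_state ::
    "(complex ^ 'n ^ 'n) set \<Rightarrow> (complex ^ 'n ^ 'n \<Rightarrow> complex) \<Rightarrow> bool" where
  "faithful_state B \<psi> \<longleftrightarrow>
     linear_on_alg B \<psi> \<and> \<psi> (mat 1) = 1 \<and>
     (\<forall>a\<in>B. \<psi> (cadj a ** a) \<in> \<real>\<^sub>\<ge>\<^sub>0) \<and>
     (\<forall>a\<in>B. \<psi> (cadj a ** a) = 0 \<longrightarrow> a = 0)"

definition positive_in :: "(complex ^ 'n ^ 'n) set \<Rightarrow> complex ^ 'n ^ 'n \<Rightarrow> bool" where
  "positive_in B q \<longleftrightarrow> (\<exists>b\<in>B. q = cadj b ** b)"

text \<open>Functional calculus: the power \<open>Q\<^sup>w\<close> of a positive invertible matrix acts as \<open>\<lambda>\<^sup>w\<close> on the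
  eigenvectors of \<open>Q\<close> with eigenvalue \<open>\<lambda>\<close>.\<close>

definition cmpow :: "complex ^ 'n ^ 'n \<Rightarrow> complex \<Rightarrow> complex ^ 'n ^ 'n" where
  "cmpow Q w = (THE P. \<forall>l v. Q *v v = l *s v \<longrightarrow> P *v v = (l powr w) *s v)"

definition modular :: "complex ^ 'n ^ 'n \<Rightarrow> complex \<Rightarrow> complex ^ 'n ^ 'n \<Rightarrow> complex ^ 'n ^ 'n" where
  "modular Q z a = cmpow Q (\<i> * z) ** a ** cmpow Q (- (\<i> * z))"

text \<open>Spaces of matrices \<open>V\<close>, \<open>W\<close> have their tensor product realised as the span of the Kronecker
  products.  \<open>tlift V W \<beta>\<close> is the linear map on it with value \<open>\<beta> a b\<close> at \<open>kron a b\<close>, for \<open>\<beta>\<close>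
  bilinear on \<open>V \<times> W\<close>.\<close>

definition kron :: "complex ^ 'n ^ 'n \<Rightarrow> complex ^ 'm ^ 'm \<Rightarrow> complex ^ ('n \<times> 'm) ^ ('n \<times> 'm)" where
  "kron a b = (\<chi> p q. a $ fst p $ fst q * b $ snd p $ snd q)"

definition tensor_space ::
    "(complex ^ 'n ^ 'n) set \<Rightarrow> (complex ^ 'm ^ 'm) set \<Rightarrow>
      (complex ^ ('n \<times> 'm) ^ ('n \<times> 'm)) set" where
  "tensor_space V W =
     {X. \<exists>(N::nat) a b. (\<forall>k<N. a k \<in> V \<and> b k \<in> W) \<and> X = (\<Sum>k<N. kron (a k) (b k))}"

definition tlift ::
    "(complex ^ 'n ^ 'n) set \<Rightarrow> (complex ^ 'm ^ 'm) set \<Rightarrow>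
      (complex ^ 'n ^ 'n \<Rightarrow> complex ^ 'm ^ 'm \<Rightarrow> 'c::comm_monoid_add) \<Rightarrow>
      complex ^ ('n \<times> 'm) ^ ('n \<times> 'm) \<Rightarrow> 'c" where
  "tlift V W \<beta> X =
     (THE Y. \<exists>(N::nat) a b. (\<forall>k<N. a k \<in> V \<and> b k \<in> W) \<and>
        X = (\<Sum>k<N. kron (a k) (b k)) \<and> Y = (\<Sum>k<N. \<beta> (a k) (b k)))"

definition op_tensor ::
    "(complex ^ 'n ^ 'n) set \<Rightarrow> (complex ^ 'm ^ 'm) set \<Rightarrow>
      (complex ^ 'n ^ 'n \<Rightarrow> complex ^ 'n ^ 'n) \<Rightarrow> (complex ^ 'm ^ 'm \<Rightarrow> complex ^ 'm ^ 'm) \<Rightarrow>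
      complex ^ ('n \<times> 'm) ^ ('n \<times> 'm) \<Rightarrow> complex ^ ('n \<times> 'm) ^ ('n \<times> 'm)" where
  "op_tensor V W S T = tlift V W (\<lambda>a b. kron (S a) (T b))"

text \<open>The inner product with \<open>(a \<otimes> b | c \<otimes> d) = (a | c) (b | d)\<close>: the inner \<open>tlift\<close> is the linear
  functional \<open>(c \<otimes> d | _)\<close>, whose conjugate at \<open>X\<close> is \<open>(X | c \<otimes> d)\<close>.\<close>

definition tensor_ip ::
    "(complex ^ 'n ^ 'n) set \<Rightarrow> (complex ^ 'm ^ 'm) set \<Rightarrow>
      (complex ^ 'n ^ 'n \<Rightarrow> complex ^ 'n ^ 'n \<Rightarrow> complex) \<Rightarrow>
      (complex ^ 'm ^ 'm \<Rightarrow> complex ^ 'm ^ 'm \<Rightarrow> complex) \<Rightarrow>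
      complex ^ ('n \<times> 'm) ^ ('n \<times> 'm) \<Rightarrow> complex ^ ('n \<times> 'm) ^ ('n \<times> 'm) \<Rightarrow> complex" where
  "tensor_ip V W p q X Y =
     tlift V W (\<lambda>c d. cnj (tlift V W (\<lambda>a b. p c a * q d b) X)) Y"

text \<open>Hilbert space adjoint of a map \<open>T\<close> from \<open>(S, p)\<close> to a space with inner product \<open>q\<close>.\<close>

definition hadjoint ::
    "'a set \<Rightarrow> ('a \<Rightarrow> 'a \<Rightarrow> complex) \<Rightarrow> ('b \<Rightarrow> 'b \<Rightarrow> complex) \<Rightarrow> ('a \<Rightarrow> 'b) \<Rightarrow> 'b \<Rightarrow> 'a" where
  "hadjoint S p q T y = (THE x. x \<in> S \<and> (\<forall>z\<in>S. q (T z) y = p z x))"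

text \<open>\<open>L\<^sup>2(B)\<close> is the vector space \<open>B\<close> with the inner product \<open>gns \<psi>\<close>, and the GNS map is the
  identity.  Operators on \<open>L\<^sup>2(B)\<close> are functions on the ambient matrix type of which only the
  values on \<open>B\<close> matter.\<close>

definition gns :: "(complex ^ 'n ^ 'n \<Rightarrow> complex) \<Rightarrow> complex ^ 'n ^ 'n \<Rightarrow> complex ^ 'n ^ 'n \<Rightarrow> complex"
  where "gns \<psi> a b = \<psi> (cadj a ** b)"

definition operator_on ::
    "(complex ^ 'n ^ 'n) set \<Rightarrow> (complex ^ 'n ^ 'n \<Rightarrow> complex ^ 'n ^ 'n) \<Rightarrow> bool" where
  "operator_on B T \<longleftrightarrow>
     (\<forall>a\<in>B. T a \<in> B) \<and> (\<forall>a\<in>B. \<forall>b\<in>B. T (a + b) = T a + T b) \<and>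
     (\<forall>c. \<forall>a\<in>B. T (cscale c a) = cscale c (T a))"

definition selfadjoint_on ::
    "(complex ^ 'n ^ 'n) set \<Rightarrow> (complex ^ 'n ^ 'n \<Rightarrow> complex) \<Rightarrow>
      (complex ^ 'n ^ 'n \<Rightarrow> complex ^ 'n ^ 'n) \<Rightarrow> bool" where
  "selfadjoint_on B \<psi> T \<longleftrightarrow> (\<forall>a\<in>B. \<forall>b\<in>B. gns \<psi> (T a) b = gns \<psi> a (T b))"

definition rank_one ::
    "(complex ^ 'n ^ 'n \<Rightarrow> complex) \<Rightarrow> complex ^ 'n ^ 'n \<Rightarrow> complex ^ 'n ^ 'n \<Rightarrow>
      complex ^ 'n ^ 'n \<Rightarrow> complex ^ 'n ^ 'n" where
  "rank_one \<psi> a b c = cscale (gns \<psi> a c) b"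

definition mult_map ::
    "(complex ^ 'n ^ 'n) set \<Rightarrow> complex ^ ('n \<times> 'n) ^ ('n \<times> 'n) \<Rightarrow> complex ^ 'n ^ 'n" where
  "mult_map B = tlift B B (\<lambda>a b. a ** b)"

definition mult_adj ::
    "(complex ^ 'n ^ 'n) set \<Rightarrow> (complex ^ 'n ^ 'n \<Rightarrow> complex) \<Rightarrow>
      complex ^ 'n ^ 'n \<Rightarrow> complex ^ ('n \<times> 'n) ^ ('n \<times> 'n)" where
  "mult_adj B \<psi> =
     hadjoint (tensor_space B B) (tensor_ip B B (gns \<psi>) (gns \<psi>)) (gns \<psi>) (mult_map B)"

definition unit_map :: "complex \<Rightarrow> complex ^ 'n ^ 'n" where
  "unit_map c = cscale c (mat 1)"

definition unit_adj :: "(complex ^ 'n ^ 'n \<Rightarrow> complex) \<Rightarrow> complex ^ 'n ^ 'n \<Rightarrow> complex" where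
  "unit_adj \<psi> = hadjoint UNIV (\<lambda>x y. cnj x * y) (gns \<psi>) unit_map"

text \<open>The two outer factors of \<open>(1 \<otimes> \<eta>\<^sup>*m)(1 \<otimes> A \<otimes> 1)(m\<^sup>*\<eta> \<otimes> 1)\<close>, with
  \<open>\<complex> \<otimes> L\<^sup>2(B)\<close> and \<open>L\<^sup>2(B) \<otimes> \<complex>\<close> identified with \<open>L\<^sup>2(B)\<close>.  Triple tensor products are bracketed to
  the right, so the result of \<open>m\<^sup>*\<eta> \<otimes> 1\<close> is reassociated.\<close>

definition assoc_right ::
    "(complex ^ 'n ^ 'n) set \<Rightarrow> complex ^ (('n \<times> 'n) \<times> 'n) ^ (('n \<times> 'n) \<times> 'n) \<Rightarrow>
      complex ^ ('n \<times> ('n \<times> 'n)) ^ ('n \<times> ('n \<times> 'n))" where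
  "assoc_right B =
     tlift (tensor_space B B) B (\<lambda>X c. tlift B B (\<lambda>a b. kron a (kron b c)) X)"

definition cup_left ::
    "(complex ^ 'n ^ 'n) set \<Rightarrow> (complex ^ 'n ^ 'n \<Rightarrow> complex) \<Rightarrow>
      complex ^ 'n ^ 'n \<Rightarrow> complex ^ ('n \<times> ('n \<times> 'n)) ^ ('n \<times> ('n \<times> 'n))" where
  "cup_left B \<psi> c = assoc_right B (kron (mult_adj B \<psi> (unit_map 1)) c)"

definition cap_right ::
    "(complex ^ 'n ^ 'n) set \<Rightarrow> (complex ^ 'n ^ 'n \<Rightarrow> complex) \<Rightarrow>
      complex ^ ('n \<times> ('n \<times> 'n)) ^ ('n \<times> ('n \<times> 'n)) \<Rightarrow> complex ^ 'n ^ 'n" where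
  "cap_right B \<psi> =
     tlift B (tensor_space B B) (\<lambda>a X. cscale (unit_adj \<psi> (mult_map B X)) a)"

text \<open>Both maps \<open>\<Psi>\<close> are the linear extension from rank one operators.  The space
  \<open>B \<otimes> B\<^sup>o\<^sup>p\<close> is \<open>tensor_space B B\<close>; no definition below uses its product.\<close>

definition Psi_0_half ::
    "(complex ^ 'n ^ 'n) set \<Rightarrow> (complex ^ 'n ^ 'n \<Rightarrow> complex) \<Rightarrow> complex ^ 'n ^ 'n \<Rightarrow>
      (complex ^ 'n ^ 'n \<Rightarrow> complex ^ 'n ^ 'n) \<Rightarrow> complex ^ ('n \<times> 'n) ^ ('n \<times> 'n)" where
  "Psi_0_half B \<psi> Q A =
     (THE X. \<exists>(N::nat) a b. (\<forall>k<N. a k \<in> B \<and> b k \<in> B) \<and>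
        (\<forall>c\<in>B. A c = (\<Sum>k<N. rank_one \<psi> (a k) (b k) c)) \<and>
        X = (\<Sum>k<N. kron (cadj (a k)) (modular Q (\<i> / 2) (b k))))"

definition Psi'_half_0 ::
    "(complex ^ 'n ^ 'n) set \<Rightarrow> (complex ^ 'n ^ 'n \<Rightarrow> complex) \<Rightarrow> complex ^ 'n ^ 'n \<Rightarrow>
      (complex ^ 'n ^ 'n \<Rightarrow> complex ^ 'n ^ 'n) \<Rightarrow> complex ^ ('n \<times> 'n) ^ ('n \<times> 'n)" where
  "Psi'_half_0 B \<psi> Q A =
     (THE X. \<exists>(N::nat) a b. (\<forall>k<N. a k \<in> B \<and> b k \<in> B) \<and>
        (\<forall>c\<in>B. A c = (\<Sum>k<N. rank_one \<psi> (a k) (b k) c)) \<and>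
        X = (\<Sum>k<N. kron (modular Q (\<i> / 2) (b k)) (cadj (a k))))"

definition bop_action ::
    "(complex ^ 'n ^ 'n) set \<Rightarrow> complex ^ ('n \<times> 'n) ^ ('n \<times> 'n) \<Rightarrow>
      complex ^ ('n \<times> 'n) ^ ('n \<times> 'n)" where
  "bop_action B = tlift B B (\<lambda>a b. kron a (transpose b))"

end

theory Submission
  imports Defs "HOL-Computational_Algebra.Fundamental_Theorem_Algebra"
begin

text \<open>Let \<open>(h\<^sub>k)\<close> be a Parseval frame of \<open>L\<^sup>2(B)\<close>.  Then \<open>m\<^sup>*(a) = \<Sum> h\<^sub>k \<otimes> h\<^sub>k\<^sup>* a\<close>, so
  \<open>m(A \<otimes> 1)m\<^sup>*(a) = W\<^sub>1 a\<close> with \<open>W\<^sub>1 = \<Sum> A(h\<^sub>k) h\<^sub>k\<^sup>*\<close>, and the KMS property of \<open>\<psi>\<close> gives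
  \<open>m(1 \<otimes> A)m\<^sup>*(a) = a Q W\<^sub>2\<close> with \<open>W\<^sub>2 = \<Sum> h\<^sub>k\<^sup>* Q\<^sup>-\<^sup>1 A(h\<^sub>k)\<close>.  Undirectedness of \<open>A\<close> implies
  that \<open>W\<^sub>1 = Q W\<^sub>2\<close>.  Identifying \<open>H \<otimes> \<close>conjugate-\<open>H\<close> with the matrices, \<open>a \<otimes> b\<close> acts as
  \<open>M \<mapsto> a M b\<close> and \<open>u\<^sub>0\<close>, \<open>u\<^sub>1\<close> both become \<open>Q\<^sup>-\<^sup>1\<^sup>/\<^sup>2\<close>; hence each of \<open>e u\<^sub>0\<close>, \<open>e\<^sup>* u\<^sub>0\<close> and the
  element in (4) is \<open>W\<^sub>1\<close>, \<open>W\<^sub>2\<close> or an adjoint of these, up to invertible factors.\<close>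

subsection \<open>Complex matrices\<close>

text \<open>The powers of \<open>Q\<close>, the lifts to tensor products, the adjoints and both
  \<Psi> maps are definite descriptions, so a value and its uniqueness must be established before
  anything can be computed. For the powers this is polynomial functional calculus, which also keeps
  them inside \<open>B\<close>. For the lifts it is a statement about linear relations between
  Kronecker products. For the adjoint of multiplication and the \<Psi> maps it is frame expansion. A
  frame is preferred to an orthonormal basis because only the reconstruction of an element from its
  coefficients enters, never independence or norms.

  The relation between \<open>W1\<close> and \<open>W2\<close> does more than identify the two forms
  of (1). For either choice of \<open>e\<close>, one of \<open>e\<close> and its adjoint leads from
  \<open>u0\<close> to \<open>W1\<close> and the other to \<open>W2\<close>, up to adjoints and
  invertible factors. Conditions (2) and (3) thus concern different contractions of
  \<open>A\<close>, and undirectedness is what compares them.\<close>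

lemma cscale_nth [simp]: "cscale c a $ i $ j = c * a $ i $ j"
  by (simp add: cscale_def)

lemma cscale_simps [simp]:
  "cscale 1 a = a" "cscale 0 a = 0" "cscale c 0 = 0" "cscale c (cscale d a) = cscale (c * d) a"
  by (simp_all add: vec_eq_iff)

lemma cscale_add: "cscale c (a + b) = cscale c a + cscale c b"
  and cscale_left_add: "cscale (c + d) a = cscale c a + cscale d a"
  by (simp_all add: vec_eq_iff algebra_simps)

lemma cscale_sum: "cscale c (sum g I) = (\<Sum>i\<in>I. cscale c (g i))"
  by (simp add: vec_eq_iff sum_distrib_left)

lemma cscale_left_sum: "cscale (sum g I) a = (\<Sum>i\<in>I. cscale (g i) a)"
  by (simp add: vec_eq_iff sum_distrib_right)

lemma cscale_of_real: "cscale (complex_of_real r) a = r *\<^sub>R a"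
  unfolding vec_eq_iff by (simp add: scaleR_conv_of_real[where 'a = complex])

lemma cscale_mat_1_vector: "cscale c (mat 1) *v v = c *s v"
  by (simp add: vec_eq_iff matrix_vector_mult_def mat_def if_distrib if_distribR cong: if_cong)

lemma cscale_matrix_mult: "cscale c a ** b = cscale c (a ** b)"
  and matrix_mult_cscale: "a ** cscale c b = cscale c (a ** b)"
  by (simp_all add: vec_eq_iff matrix_matrix_mult_def sum_distrib_left mult_ac)

lemma matrix_mult_add_rdistrib: "(a + b) ** c = a ** c + b ** (c :: complex ^ 'n ^ 'n)"
  by (simp add: vec_eq_iff matrix_matrix_mult_def algebra_simps sum.distrib)

lemma matrix_mult_sum_left: "sum g I ** b = (\<Sum>i\<in>I. g i ** (b :: complex ^ 'n ^ 'n))"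
  by (induction I rule: infinite_finite_induct) (simp_all add: matrix_mult_add_rdistrib)

lemma matrix_mult_sum_right: "b ** sum g I = (\<Sum>i\<in>I. (b :: complex ^ 'n ^ 'n) ** g i)"
  by (induction I rule: infinite_finite_induct) (simp_all add: matrix_add_ldistrib)

lemma cadj_nth [simp]: "cadj a $ i $ j = cnj (a $ j $ i)"
  by (simp add: cadj_def)

lemma cadj_simps [simp]:
  "cadj (cadj a) = a" "cadj 0 = 0" "cadj (mat 1) = mat 1" "cadj (a ** b) = cadj b ** cadj a"
  "cadj (a + b) = cadj a + cadj b" "cadj (cscale c a) = cscale (cnj c) (cadj a)"
  by (auto simp: vec_eq_iff mat_def matrix_matrix_mult_def mult.commute)

lemma cadj_sum: "cadj (sum g I) = (\<Sum>i\<in>I. cadj (g i))"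
  by (induction I rule: infinite_finite_induct) simp_all

lemma cadj_eq_0_iff [simp]: "cadj a = 0 \<longleftrightarrow> a = 0"
  by (metis cadj_simps(1,2))

lemma cinner_add_right: "cinner u (v + w) = cinner u v + cinner u w"
  and cinner_scale_right: "cinner u (c *s v) = c * cinner u v"
  and cinner_zero [simp]: "cinner u 0 = 0" "cinner 0 u = 0"
  by (simp_all add: cinner_def algebra_simps sum.distrib sum_distrib_left)

lemma cinner_self: "cinner v v = of_real (\<Sum>i\<in>UNIV. (cmod (v $ i))\<^sup>2)"
  by (simp add: cinner_def mult.commute[of "cnj _"] flip: complex_norm_square)

lemma cinner_self_eq_0_iff [simp]: "cinner v v = 0 \<longleftrightarrow> v = 0"
  unfolding cinner_self of_real_eq_0_iff
  by (subst sum_nonneg_eq_0_iff) (auto simp: vec_eq_iff)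

lemma kron_nth [simp]: "kron a b $ p $ q = a $ fst p $ fst q * b $ snd p $ snd q"
  by (simp add: kron_def)

lemma kron_simps:
  "kron (a + a') b = kron a b + kron a' b" "kron a (b + b') = kron a b + kron a b'"
  "kron (cscale c a) b = cscale c (kron a b)" "kron a (cscale c b) = cscale c (kron a b)"
  "kron 0 b = 0" "kron a 0 = 0"
  by (simp_all add: vec_eq_iff algebra_simps)

lemma kron_sum_left: "kron (sum g I) b = (\<Sum>i\<in>I. kron (g i) b)"
  and kron_sum_right: "kron a (sum h I) = (\<Sum>i\<in>I. kron a (h i))"
  by (induction I rule: infinite_finite_induct) (simp_all add: kron_simps)

lemma cadj_kron: "cadj (kron a b) = kron (cadj a) (cadj b)"
  by (simp add: vec_eq_iff)

subsection \<open>Functional calculus\<close>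

definition peval :: "complex ^ 'n ^ 'n \<Rightarrow> complex poly \<Rightarrow> complex ^ 'n ^ 'n" where
  "peval q p = fold_coeffs (\<lambda>c M. cscale c (mat 1) + q ** M) p 0"

lemma peval_0 [simp]: "peval q 0 = 0"
  by (simp add: peval_def)

lemma peval_pCons [simp]: "peval q (pCons c p) = cscale c (mat 1) + q ** peval q p"
  by (cases "p = 0 \<and> c = 0") (auto simp: peval_def)

lemma peval_1 [simp]: "peval q 1 = mat 1"
  by (simp add: one_pCons)

lemma peval_add: "peval q (p + p') = peval q p + peval q p'"
  by (induction p p' rule: poly_induct2)
     (simp_all add: cscale_left_add matrix_add_ldistrib)

lemma peval_smult: "peval q (smult c p) = cscale c (peval q p)"
  by (induction p) (simp_all add: cscale_add matrix_mult_cscale)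

lemma peval_diff: "peval q (p - p') = peval q p - peval q p'"
  by (metis add_diff_cancel_right' diff_add_cancel peval_add)

lemma peval_mult: "peval q (p * p') = peval q p ** peval q p'"
  by (induction p)
     (simp_all add: peval_add peval_smult matrix_mult_add_rdistrib cscale_matrix_mult matrix_mul_assoc)

lemma peval_sum: "peval q (sum g I) = (\<Sum>i\<in>I. peval q (g i))"
  by (induction I rule: infinite_finite_induct) (simp_all add: peval_add)

lemma peval_commute: "peval q p ** peval q p' = peval q p' ** peval q p"
  by (metis mult.commute peval_mult)

lemma peval_eigenvector:
  assumes "q *v v = l *s v"
  shows "peval q p *v v = poly p l *s v"
proof (induction p)
  case (pCons c p)
  have "q *v (poly p l *s v) = (poly p l * l) *s v"
    using assms by (simp add: vec.scale)
  then show ?case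
    using pCons by (simp add: cscale_mat_1_vector matrix_vector_mult_add_rdistrib algebra_simps vec.scale_left_distrib
      flip: matrix_vector_mul_assoc)
qed simp

lemma peval_linear_vector: "peval q [:- z, 1:] *v v = q *v v - z *s v"
  using cscale_mat_1_vector[of "- z" v]
  by (simp add: matrix_vector_mult_add_rdistrib)

lemma cadj_peval:
  assumes "cadj q = q"
  shows "cadj (peval q p) = peval q (map_poly cnj p)"
proof (induction p)
  case (pCons c p)
  have "peval q p' ** q = q ** peval q p'" for p'
    using peval_commute[of q p' "[:0, 1:]"] by simp
  with pCons assms show ?case
    by (simp add: map_poly_pCons)
qed simp

text \<open>With d the real dimension of the matrix space, the powers of \<open>q\<close> from 0 to
  d are one too many to be independent. Since \<open>dependent\<close> speaks of sets, the case of
  two equal powers is split off; there the difference of two monomials annihilates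
  \<open>q\<close>.\<close>

lemma peval_annihilating_poly:
  fixes q :: "complex ^ 'n ^ 'n"
  obtains p where "p \<noteq> 0" "peval q p = 0"
proof (cases "inj_on (\<lambda>i. peval q (monom 1 i)) {..DIM(complex ^ 'n ^ 'n)}")
  case False
  then obtain i j where ij: "i \<noteq> j" "peval q (monom 1 i) = peval q (monom 1 j)"
    by (auto simp: inj_on_def)
  have "coeff (monom 1 i - monom 1 j :: complex poly) i = 1"
    using ij by simp
  then have "monom 1 i - monom 1 j \<noteq> (0 :: complex poly)"
    by force
  with ij that[of "monom 1 i - monom 1 j"] show ?thesis
    by (simp add: peval_diff)
next
  case True
  let ?M = "\<lambda>i. peval q (monom 1 i)"
  let ?I = "{..DIM(complex ^ 'n ^ 'n)}"
  have "dependent (?M ` ?I)"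
    by (rule dependent_biggerset) (use True in \<open>simp_all add: card_image\<close>)
  then obtain u i where u: "i \<in> ?I" "u (?M i) \<noteq> 0" "(\<Sum>v\<in>?M ` ?I. u v *\<^sub>R v) = 0"
    by (auto simp: dependent_finite)
  let ?p = "\<Sum>i\<in>?I. smult (of_real (u (?M i))) (monom 1 i)"
  have "peval q ?p = (\<Sum>i\<in>?I. u (?M i) *\<^sub>R ?M i)"
    by (simp add: peval_sum peval_smult cscale_of_real)
  also have "\<dots> = 0"
    using u(3) True by (simp add: sum.reindex)
  finally have "peval q ?p = 0" .
  moreover have ci: "coeff ?p i = of_real (u (?M i))"
    using u(1) by (simp add: coeff_sum coeff_monom if_distrib cong: if_cong)
  have "?p \<noteq> 0"
  proof
    assume "?p = 0"
    from arg_cong[OF this, of "\<lambda>p. coeff p i"] show False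
      using u(2) unfolding ci by simp
  qed
  ultimately show ?thesis
    using that by blast
qed

text \<open>Positivity is phrased through eigenvalues because \<open>cmpow\<close> is characterised
  only by its action on eigenvectors.\<close>

definition pos_def :: "complex ^ 'n ^ 'n \<Rightarrow> bool" where
  "pos_def q \<longleftrightarrow> cadj q = q \<and> (\<forall>l v. v \<noteq> 0 \<longrightarrow> q *v v = l *s v \<longrightarrow> (\<exists>x>0. l = complex_of_real x))"

text \<open>Pairing the eigenvector equation with \<open>v\<close> gives \<open>l\<close> times the
  squared norm of \<open>v\<close> on one side and the squared norm of \<open>b *v v\<close> on the
  other. Invertibility excludes \<open>l = 0\<close>.\<close>

lemma pos_defI:
  assumes "q = cadj b ** b" "invertible q"
  shows "pos_def q"
  unfolding pos_def_def
proof (intro conjI allI impI)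
  show "cadj q = q"
    by (simp add: assms)
  fix l v
  assume v: "v \<noteq> 0" "q *v v = l *s v"
  let ?n = "\<lambda>v :: complex ^ 'a. \<Sum>i\<in>UNIV. (cmod (v $ i))\<^sup>2"
  have "l * cinner v v = cinner v (q *v v)"
    by (simp add: v cinner_scale_right)
  also have "\<dots> = cinner (b *v v) (b *v v)"
    by (metis assms(1) cadj_simps(1) cinner_cadj matrix_vector_mul_assoc)
  finally have "l * of_real (?n v) = of_real (?n (b *v v))"
    by (simp add: cinner_self)
  moreover have nv: "?n v \<noteq> 0"
    using v(1) by (metis cinner_self cinner_self_eq_0_iff of_real_0)
  ultimately have l: "l = complex_of_real (?n (b *v v) / ?n v)"
    unfolding of_real_divide using nonzero_eq_divide_eq[of "of_real (?n v)" l "of_real (?n (b *v v))"]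
    unfolding of_real_eq_0_iff by blast
  moreover have "l \<noteq> 0"
    using v assms(2) by (metis invertible_def matrix_vector_mul_assoc matrix_vector_mul_lid
      matrix_vector_mult_0_right vec.scale_zero_left)
  moreover have "?n (b *v v) / ?n v \<ge> 0"
    by (simp add: sum_nonneg)
  ultimately show "\<exists>x>0. l = complex_of_real x"
    by (metis less_eq_real_def of_real_0)
qed

section \<open>Spectral decomposition by annihilating polynomials\<close>

definition root_poly :: "complex set \<Rightarrow> complex poly" where
  "root_poly L = (\<Prod>l\<in>L. [:- l, 1:])"

text \<open>This is diagonalisability, obtained by thinning out any annihilating polynomial: a
  linear factor at a number that is not positive real is injective and can be cancelled, while
  self-adjointness reduces a double factor to a simple one. What remains is a product over distinct
  positive numbers.\<close>

lemma pos_def_annihilating_root_poly: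
  fixes q :: "complex ^ 'n ^ 'n"
  assumes q: "pos_def q"
  shows "\<exists>L. finite L \<and> (\<forall>l\<in>L. \<exists>x>0. l = complex_of_real x) \<and> peval q (root_poly L) = 0"
proof -
  have inj: "M = 0" if "peval q [:- z, 1:] ** M = 0" "\<not> (\<exists>x>0. z = complex_of_real x)" for z and M :: "complex ^ 'n ^ 'n"
  proof (rule ccontr)
    assume "M \<noteq> 0"
    then obtain w where w: "M *v w \<noteq> 0"
      by (metis matrix_eq matrix_vector_mult_0)
    have "peval q [:- z, 1:] *v (M *v w) = 0"
      unfolding matrix_vector_mul_assoc that(1) by (rule matrix_vector_mult_0)
    then have "q *v (M *v w) = z *s (M *v w)"
      unfolding peval_linear_vector by (simp only: right_minus_eq)
    with q w that(2) show False
      by (auto simp: pos_def_def)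
  qed
  \<comment> \<open>For self-adjoint \<open>?q\<close>, the squared norm of \<open>?q *v x\<close>
    is the pairing of \<open>x\<close> with \<open>?q *v (?q *v x)\<close>.\<close>
  have sq: "peval q [:- z, 1:] ** M = 0"
    if "peval q [:- z, 1:] ** (peval q [:- z, 1:] ** M) = 0" "z = complex_of_real x" for z x and M :: "complex ^ 'n ^ 'n"
  proof -
    let ?q = "peval q [:- z, 1:]"
    have "cadj ?q = ?q"
      using q that(2) by (simp add: pos_def_def)
    then have "cinner (?q *v (M *v w)) (?q *v (M *v w)) = cinner (M *v w) (?q *v (?q *v (M *v w)))" for w
      by (metis cinner_cadj)
    moreover have "?q *v (?q *v (M *v w)) = 0" for w
      unfolding matrix_vector_mul_assoc that(1) by (rule matrix_vector_mult_0)
    ultimately have "?q *v (M *v w) = 0" for w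
      by (metis cinner_self_eq_0_iff cinner_zero(1))
    then have "(?q ** M) *v w = 0" for w
      by (simp flip: matrix_vector_mul_assoc)
    then show ?thesis
      by (metis matrix_eq matrix_vector_mult_0)
  qed
  \<comment> \<open>The matrix \<open>M\<close> absorbs the linear factors already split off, so
    that the induction hypothesis applies to the quotient polynomial.\<close>
  have main: "\<exists>L. finite L \<and> (\<forall>l\<in>L. \<exists>x>0. l = complex_of_real x) \<and> peval q (root_poly L) ** M = 0"
    if "p \<noteq> 0" "peval q p ** M = 0" for p and M :: "complex ^ 'n ^ 'n"
    using that
  proof (induction "degree p" arbitrary: p M)
    case 0
    then obtain c where "p = [:c:]" "c \<noteq> 0"
      by (metis degree_eq_zeroE pCons_0_0)
    then have "cscale (1 / c) (peval q p ** M) = M"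
      by (simp add: cscale_matrix_mult)
    then have "M = 0"
      using 0 by simp
    then show ?case
      by (intro exI[of _ "{}"]) simp
  next
    case (Suc n)
    then obtain z where "poly p z = 0"
      by (metis Fundamental_Theorem_Algebra.fundamental_theorem_of_algebra constant_degree nat.distinct(1))
    then obtain p' where p': "p = [:- z, 1:] * p'"
      by (metis poly_eq_0_iff_dvd dvdE)
    have "p' \<noteq> 0"
      using p' Suc.prems by auto
    then have "degree p' = n"
      using p' Suc.hyps(2) by (simp add: degree_mult_eq del: mult_pCons_left)
    moreover have "peval q p' ** (peval q [:- z, 1:] ** M) = 0"
      using Suc.prems(2) by (metis p' matrix_mul_assoc mult.commute peval_mult)
    ultimately obtain L where L: "finite L" "\<forall>l\<in>L. \<exists>x>0. l = complex_of_real x"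
      "peval q (root_poly L) ** (peval q [:- z, 1:] ** M) = 0"
      using Suc.hyps(1) \<open>p' \<noteq> 0\<close> by metis
    have z: "peval q [:- z, 1:] ** (peval q (root_poly L) ** M) = 0"
      using L(3) by (metis peval_commute matrix_mul_assoc)
    consider "\<not> (\<exists>x>0. z = complex_of_real x)" | "z \<in> L"
      | "z \<notin> L" "\<exists>x>0. z = complex_of_real x" by blast
    then show ?case
    proof cases
      case 1
      with inj z L show ?thesis by blast
    next
      case 2
      let ?r = "root_poly (L - {z})"
      have r: "root_poly L = [:- z, 1:] * ?r"
        unfolding root_poly_def using L(1) 2 by (simp add: prod.remove del: mult_pCons_left)
      then have "peval q [:- z, 1:] ** (peval q [:- z, 1:] ** (peval q ?r ** M)) = 0"
        using z by (metis matrix_mul_assoc peval_mult)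
      then have "peval q (root_poly L) ** M = 0"
        using sq L(2) 2 by (metis matrix_mul_assoc peval_mult r)
      with L show ?thesis by blast
    next
      case 3
      then have "root_poly (insert z L) = [:- z, 1:] * root_poly L"
        using L(1) by (simp add: root_poly_def del: mult_pCons_left)
      then have "peval q (root_poly (insert z L)) ** M = 0"
        using z by (metis matrix_mul_assoc peval_mult)
      then show ?thesis
        using L 3 by (intro exI[of _ "insert z L"]) auto
    qed
  qed
  obtain p where "p \<noteq> 0" "peval q p = 0"
    by (rule peval_annihilating_poly)
  then have "p \<noteq> 0" "peval q p ** mat 1 = 0"
    by simp_all
  from main[OF this] show ?thesis
    by simp
qed

text \<open>Newton interpolation: \<open>root_poly L\<close> vanishes at the old nodes but not at
  the new one, so a multiple of it corrects the new value.\<close>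

lemma poly_interpolation:
  fixes g :: "complex \<Rightarrow> complex"
  assumes "finite L"
  shows "\<exists>p. \<forall>l\<in>L. poly p l = g l"
  using assms
proof (induction L rule: finite_induct)
  case (insert z L)
  then obtain p where p: "\<forall>l\<in>L. poly p l = g l" by blast
  have 0: "poly (root_poly L) l = 0 \<longleftrightarrow> l \<in> L" for l
    using insert by (auto simp: root_poly_def poly_prod)
  let ?p = "p + smult ((g z - poly p z) / poly (root_poly L) z) (root_poly L)"
  have "\<forall>l\<in>insert z L. poly ?p l = g l"
    using p insert 0 by auto
  then show ?case by blast
qed simp

lemma root_poly_dvd:
  assumes "finite L" "\<And>l. l \<in> L \<Longrightarrow> poly g l = 0"
  shows "root_poly L dvd g"
  using assms
proof (induction L arbitrary: g rule: finite_induct)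
  case (insert z L)
  obtain h where h: "g = [:- z, 1:] * h"
    using insert.prems by (metis dvdE insertI1 poly_eq_0_iff_dvd)
  have "poly h l = 0" if "l \<in> L" for l
  proof -
    have "(l - z) * poly h l = 0" "l \<noteq> z"
      using insert.prems[of l] insert.hyps that by (auto simp: h)
    then show ?thesis by simp
  qed
  then have "root_poly L dvd h"
    by (rule insert.IH)
  then have "[:- z, 1:] * root_poly L dvd g"
    unfolding h by (rule mult_dvd_mono[OF dvd_refl])
  moreover have "root_poly (insert z L) = [:- z, 1:] * root_poly L"
    using insert.hyps by (simp add: root_poly_def del: mult_pCons_left)
  ultimately show ?case
    by simp
qed (simp add: root_poly_def)

text \<open>The Lagrange polynomials of the nodes in \<open>L\<close> sum to 1 modulo
  \<open>root_poly L\<close>, which annihilates \<open>q\<close>. Their values at \<open>q\<close>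
  therefore decompose \<open>mat 1\<close> into matrices whose ranges consist of eigenvectors, and
  matrices agreeing on eigenvectors agree. This yields the uniqueness required by
  \<open>cmpow\<close> and reduces identities between powers to scalars.\<close>

lemma pos_def_matrix_eqI:
  fixes q M M' :: "complex ^ 'n ^ 'n"
  assumes q: "pos_def q"
    and eq: "\<And>x v. 0 < x \<Longrightarrow> q *v v = complex_of_real x *s v \<Longrightarrow> M *v v = M' *v v"
  shows "M = M'"
proof -
  obtain L where L: "finite L" "\<forall>l\<in>L. \<exists>x>0. l = complex_of_real x"
    "peval q (root_poly L) = 0"
    using pos_def_annihilating_root_poly[OF q] by blast
  define E where "E z = root_poly (L - {z})" for z
  define c where "c z = 1 / poly (E z) z" for z
  have E0: "poly (E z) l = 0 \<longleftrightarrow> l \<in> L - {z}" for z l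
    using L(1) by (auto simp: E_def root_poly_def poly_prod)
  define s where "s = (\<Sum>z\<in>L. smult (c z) (E z))"
  have "poly (s - 1) l = 0" if "l \<in> L" for l
  proof -
    have "poly s l = (\<Sum>z\<in>L. if z = l then 1 else 0)"
      unfolding s_def poly_sum using that E0 by (intro sum.cong) (auto simp: c_def)
    then show ?thesis
      using that L(1) by simp
  qed
  then have "root_poly L dvd s - 1"
    using L(1) root_poly_dvd by blast
  then have "peval q (s - 1) = 0"
    using L(3) by (metis dvdE times0_left peval_mult)
  then have 1: "peval q s = mat 1"
    unfolding peval_diff peval_1 right_minus_eq .
  have E: "M ** peval q (E z) = M' ** peval q (E z)" if z: "z \<in> L" for z
  proof -
    have "root_poly L = [:- z, 1:] * E z"
      unfolding root_poly_def E_def using L(1) z by (simp add: prod.remove del: mult_pCons_left)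
    then have 0: "peval q [:- z, 1:] ** peval q (E z) = 0"
      using L(3) by (metis peval_mult)
    have "M *v (peval q (E z) *v w) = M' *v (peval q (E z) *v w)" for w
    proof -
      have "peval q [:- z, 1:] *v (peval q (E z) *v w) = 0"
        unfolding matrix_vector_mul_assoc 0 by (rule matrix_vector_mult_0)
      then have "q *v (peval q (E z) *v w) = z *s (peval q (E z) *v w)"
        unfolding peval_linear_vector by (simp only: right_minus_eq)
      moreover obtain x where "0 < x" "z = complex_of_real x"
        using L(2) z by blast
      ultimately show ?thesis
        using eq[of x "peval q (E z) *v w"] by simp
    qed
    then show ?thesis
      by (simp add: matrix_eq flip: matrix_vector_mul_assoc)
  qed
  have "M = M ** peval q s"
    by (simp add: 1)
  also have "\<dots> = M' ** peval q s"
    unfolding s_def peval_sum peval_smult matrix_mult_sum_right matrix_mult_cscale using E by simp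
  also have "\<dots> = M'"
    by (simp add: 1)
  finally show ?thesis .
qed

text \<open>An interpolating polynomial realises the power, so the power lies in every unital
  algebra containing \<open>q\<close>. The values of the polynomial are controlled only at true
  eigenvalues: a zero vector would satisfy the equation for every \<open>x\<close>.\<close>

lemma cmpow_peval:
  fixes q :: "complex ^ 'n ^ 'n"
  assumes q: "pos_def q"
  obtains p where "cmpow q w = peval q p"
    and "\<And>x v. 0 < x \<Longrightarrow> q *v v = complex_of_real x *s v \<Longrightarrow> v \<noteq> 0 \<Longrightarrow> poly p (of_real x) = of_real x powr w"
proof -
  obtain L where L: "finite L" "\<forall>l\<in>L. \<exists>x>0. l = complex_of_real x"
    "peval q (root_poly L) = 0"
    using pos_def_annihilating_root_poly[OF q] by blast
  obtain p where p: "\<forall>l\<in>L. poly p l = l powr w"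
    using poly_interpolation[OF L(1), of "\<lambda>l. l powr w"] by blast
  have inL: "l \<in> L" if "q *v v = l *s v" "v \<noteq> 0" for l v
  proof -
    have "poly (root_poly L) l *s v = 0"
      using peval_eigenvector[OF that(1), of "root_poly L"] L(3) by simp
    with that(2) have "poly (root_poly L) l = 0"
      by simp
    then show ?thesis
      using L(1) by (auto simp: root_poly_def poly_prod)
  qed
  have "cmpow q w = peval q p"
    unfolding cmpow_def
  proof (rule the_equality)
    show P: "\<forall>l v. q *v v = l *s v \<longrightarrow> peval q p *v v = l powr w *s v"
    proof (intro allI impI)
      fix l v assume v: "q *v v = l *s v"
      show "peval q p *v v = l powr w *s v"
        by (cases "v = 0") (use v inL p in \<open>auto simp: peval_eigenvector\<close>)
    qed
    show "P = peval q p" if "\<forall>l v. q *v v = l *s v \<longrightarrow> P *v v = l powr w *s v" for P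
    proof (rule pos_def_matrix_eqI[OF q])
      fix x v assume v: "q *v v = complex_of_real x *s v"
      show "P *v v = peval q p *v v"
        using that[rule_format, OF v] P[rule_format, OF v] by (rule trans[OF _ sym])
    qed
  qed
  moreover have "poly p (of_real x) = of_real x powr w"
    if "q *v v = complex_of_real x *s v" "v \<noteq> 0" for x v
    using inL[OF that] p by blast
  ultimately show thesis
    by (rule that)
qed

text \<open>On eigenvectors everything becomes an identity of scalar powers. For the adjoint,
  conjugating the coefficients of the polynomial changes nothing, since a positive eigenvalue and
  its real power are both real.\<close>

lemma
  fixes q :: "complex ^ 'n ^ 'n"
  assumes q: "pos_def q"
  shows cmpow_add: "cmpow q v ** cmpow q w = cmpow q (v + w)"
    and cmpow_0: "cmpow q 0 = mat 1"
    and cmpow_1: "cmpow q 1 = q"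
    and cadj_cmpow: "cadj (cmpow q (of_real r)) = cmpow q (of_real r)"
proof -
  have ev: "cmpow q w *v u = (of_real x powr w) *s u" if "0 < x" "q *v u = complex_of_real x *s u" for w x u
    by (rule cmpow_peval[OF q, of w], cases "u = 0") (use that in \<open>auto simp: peval_eigenvector\<close>)
  show "cmpow q v ** cmpow q w = cmpow q (v + w)"
    by (rule pos_def_matrix_eqI[OF q])
       (simp add: ev powr_add vec.scale mult.commute flip: matrix_vector_mul_assoc)
  show "cmpow q 0 = mat 1" "cmpow q 1 = q"
    by (rule pos_def_matrix_eqI[OF q], simp add: ev powr_def exp_of_real)+
  obtain p where p: "cmpow q (of_real r) = peval q p"
    "\<And>x v. 0 < x \<Longrightarrow> q *v v = complex_of_real x *s v \<Longrightarrow> v \<noteq> 0 \<Longrightarrow> poly p (of_real x) = of_real x powr (of_real r)"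
    using cmpow_peval[OF q] by blast
  have *: "cadj (cmpow q (of_real r)) = peval q (map_poly cnj p)"
    using q by (simp add: p(1) cadj_peval pos_def_def)
  have cp: "poly (map_poly cnj p) (of_real x) = cnj (poly p (of_real x))" for x
    by (induction p) (simp_all add: map_poly_pCons)
  show "cadj (cmpow q (of_real r)) = cmpow q (of_real r)"
    unfolding *
  proof (rule pos_def_matrix_eqI[OF q])
    fix x u assume u: "0 < x" "q *v u = complex_of_real x *s u"
    show "peval q (map_poly cnj p) *v u = cmpow q (of_real r) *v u"
    proof (cases "u = 0")
      case False
      then show ?thesis
        using u p(2)[OF u] by (simp add: ev peval_eigenvector cp powr_of_real)
    qed simp
  qed
qed

subsection \<open>Tensor products of matrix spaces\<close>

definition csubspace :: "(complex ^ 'n ^ 'm) set \<Rightarrow> bool" where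
  "csubspace V \<longleftrightarrow> 0 \<in> V \<and> (\<forall>a\<in>V. \<forall>b\<in>V. a + b \<in> V) \<and> (\<forall>c. \<forall>a\<in>V. cscale c a \<in> V)"

lemma csubspace_sum: "csubspace V \<Longrightarrow> (\<And>i. i \<in> I \<Longrightarrow> g i \<in> V) \<Longrightarrow> sum g I \<in> V"
  by (induction I rule: infinite_finite_induct) (auto simp: csubspace_def)

text \<open>For additive \<open>\<beta>\<close> the last clause is all of complex bilinearity that well-definedness on the tensor
  product needs; the codomain carries no scalar multiplication.\<close>

definition balanced_on ::
    "(complex ^ 'n ^ 'n) set \<Rightarrow> (complex ^ 'm ^ 'm) set \<Rightarrow>
      (complex ^ 'n ^ 'n \<Rightarrow> complex ^ 'm ^ 'm \<Rightarrow> 'c::ab_group_add) \<Rightarrow> bool" where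
  "balanced_on V W \<beta> \<longleftrightarrow>
     (\<forall>a\<in>V. \<forall>a'\<in>V. \<forall>b\<in>W. \<beta> (a + a') b = \<beta> a b + \<beta> a' b) \<and>
     (\<forall>a\<in>V. \<forall>b\<in>W. \<forall>b'\<in>W. \<beta> a (b + b') = \<beta> a b + \<beta> a b') \<and>
     (\<forall>c. \<forall>a\<in>V. \<forall>b\<in>W. \<beta> (cscale c a) b = \<beta> a (cscale c b))"

lemma balanced_onI:
  assumes "\<And>a a' b. a \<in> V \<Longrightarrow> a' \<in> V \<Longrightarrow> b \<in> W \<Longrightarrow> \<beta> (a + a') b = \<beta> a b + \<beta> a' b"
    and "\<And>a b b'. a \<in> V \<Longrightarrow> b \<in> W \<Longrightarrow> b' \<in> W \<Longrightarrow> \<beta> a (b + b') = \<beta> a b + \<beta> a b'"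
    and "\<And>c a b. a \<in> V \<Longrightarrow> b \<in> W \<Longrightarrow> \<beta> (cscale c a) b = \<beta> a (cscale c b)"
  shows "balanced_on V W \<beta>"
  using assms by (simp add: balanced_on_def)

locale tensor_pair =
  fixes V :: "(complex ^ 'n ^ 'n) set" and W :: "(complex ^ 'm ^ 'm) set"
  assumes V: "csubspace V" and W: "csubspace W"
begin

lemma balanced_on_zero:
  assumes "balanced_on V W \<beta>"
  shows "b \<in> W \<Longrightarrow> \<beta> 0 b = 0" and "a \<in> V \<Longrightarrow> \<beta> a 0 = 0"
proof -
  have 0: "0 \<in> V" "0 \<in> W"
    using V W by (auto simp: csubspace_def)
  show "\<beta> 0 b = 0" if "b \<in> W"
  proof -
    have "\<beta> (0 + 0) b = \<beta> 0 b + \<beta> 0 b"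
      using assms 0 that unfolding balanced_on_def by blast
    then show ?thesis by simp
  qed
  show "\<beta> a 0 = 0" if "a \<in> V"
  proof -
    have "\<beta> a (0 + 0) = \<beta> a 0 + \<beta> a 0"
      using assms 0 that unfolding balanced_on_def by blast
    then show ?thesis by simp
  qed
qed

lemma balanced_on_sum_left:
  assumes "balanced_on V W \<beta>" "b \<in> W" "\<And>i. i \<in> I \<Longrightarrow> g i \<in> V"
  shows "\<beta> (sum g I) b = (\<Sum>i\<in>I. \<beta> (g i) b)"
  using assms(3)
proof (induction I rule: infinite_finite_induct)
  case (insert i I)
  then have "sum g I \<in> V"
    using csubspace_sum[OF V] by blast
  with insert assms(1,2) show ?case
    by (simp add: balanced_on_def)
qed (use assms(1,2) balanced_on_zero in auto)

text \<open>One summand is eliminated by expressing its left factor through the others, using a nonzero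
  entry of its right factor.\<close>

lemma balanced_sum_eq_0:
  assumes \<beta>: "balanced_on V W \<beta>" and "finite I"
    and "\<And>i. i \<in> I \<Longrightarrow> a i \<in> V" "\<And>i. i \<in> I \<Longrightarrow> b i \<in> W"
    and "(\<Sum>i\<in>I. kron (a i) (b i)) = 0"
  shows "(\<Sum>i\<in>I. \<beta> (a i) (b i)) = 0"
  using assms(2-)
proof (induction I arbitrary: b rule: finite_induct)
  case (insert x I)
  show ?case
  proof (cases "b x = 0")
    case True
    then have "\<beta> (a x) (b x) = 0"
      using balanced_on_zero(2)[OF \<beta>, of "a x"] insert.prems(1) by simp
    moreover have "(\<Sum>i\<in>I. \<beta> (a i) (b i)) = 0"
      by (rule insert.IH) (use insert True in \<open>auto simp: kron_simps\<close>)
    ultimately show ?thesis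
      using insert.hyps by simp
  next
    case False
    then obtain p q where pq: "b x $ p $ q \<noteq> 0"
      by (auto simp: vec_eq_iff)
    define t where "t i = - (b i $ p $ q / b x $ p $ q)" for i
    have ax: "a x = (\<Sum>i\<in>I. cscale (t i) (a i))"
    proof -
      have "(\<Sum>i\<in>insert x I. kron (a i) (b i)) $ (k, p) $ (l, q) = 0" for k l
        using insert.prems(3) by simp
      then have "a x $ k $ l * b x $ p $ q + (\<Sum>i\<in>I. a i $ k $ l * b i $ p $ q) = 0" for k l
        using insert.hyps by simp
      then have "a x $ k $ l = - (\<Sum>i\<in>I. a i $ k $ l * b i $ p $ q) / b x $ p $ q" for k l
        using pq by (simp add: field_simps eq_neg_iff_add_eq_0)
      then have "a x $ k $ l = (\<Sum>i\<in>I. t i * a i $ k $ l)" for k l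
        by (simp add: t_def sum_divide_distrib sum_negf mult.commute)
      then show ?thesis
        by (simp add: vec_eq_iff)
    qed
    \<comment> \<open>Substituting the expression for \<open>a x\<close> distributes the eliminated
      summand over the right factors of the others. The right factors change in this way, which is
      why the induction leaves \<open>b\<close> arbitrary.\<close>
    define b' where "b' i = b i + cscale (t i) (b x)" for i
    have b': "b' i \<in> W" if "i \<in> I" for i
      using that insert.prems W by (auto simp: b'_def csubspace_def)
    have ta: "cscale (t i) (a i) \<in> V" "cscale (t i) (b x) \<in> W" if "i \<in> I" for i
      using that insert.prems V W by (auto simp: csubspace_def)
    have "(\<Sum>i\<in>I. kron (a i) (b' i)) = (\<Sum>i\<in>I. kron (a i) (b i)) + kron (a x) (b x)"
      by (simp add: ax b'_def kron_simps sum.distrib kron_sum_left)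
    also have "\<dots> = 0"
      using insert.prems(3) insert.hyps by (simp add: add.commute)
    finally have "(\<Sum>i\<in>I. \<beta> (a i) (b' i)) = 0"
      by (intro insert.IH) (use insert.prems b' in auto)
    moreover have "\<beta> (a i) (b' i) = \<beta> (a i) (b i) + \<beta> (cscale (t i) (a i)) (b x)" if "i \<in> I" for i
      using \<beta> that insert.prems ta by (simp add: b'_def balanced_on_def)
    ultimately have "(\<Sum>i\<in>I. \<beta> (a i) (b i)) + (\<Sum>i\<in>I. \<beta> (cscale (t i) (a i)) (b x)) = 0"
      by (simp add: sum.distrib)
    also have "(\<Sum>i\<in>I. \<beta> (cscale (t i) (a i)) (b x)) = \<beta> (a x) (b x)"
      unfolding ax by (rule balanced_on_sum_left[OF \<beta>, symmetric]) (use insert.prems ta in auto)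
    finally show ?thesis
      using insert.hyps by (simp add: add.commute)
  qed
qed simp

text \<open>The vanishing criterion is applied to the difference of the two sums, indexed by a
  disjoint union, with the sign placed in the left factors of the second family.\<close>

lemma balanced_sum_cong:
  assumes \<beta>: "balanced_on V W \<beta>" and fin: "finite I" "finite J"
    and I: "\<And>i. i \<in> I \<Longrightarrow> a i \<in> V" "\<And>i. i \<in> I \<Longrightarrow> b i \<in> W"
    and J: "\<And>i. i \<in> J \<Longrightarrow> a' i \<in> V" "\<And>i. i \<in> J \<Longrightarrow> b' i \<in> W"
    and eq: "(\<Sum>i\<in>I. kron (a i) (b i)) = (\<Sum>i\<in>J. kron (a' i) (b' i))"
  shows "(\<Sum>i\<in>I. \<beta> (a i) (b i)) = (\<Sum>i\<in>J. \<beta> (a' i) (b' i))"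
proof -
  let ?a = "case_sum a (\<lambda>i. cscale (- 1) (a' i))"
  let ?b = "case_sum b b'"
  have V': "cscale (- 1) (a' i) \<in> V" if "i \<in> J" for i
    using J V that by (auto simp: csubspace_def)
  have "kron (cscale (- 1) x) y = - kron x y" for x :: "complex ^ 'n ^ 'n" and y :: "complex ^ 'm ^ 'm"
    by (simp add: vec_eq_iff)
  then have "(\<Sum>i\<in>I <+> J. kron (?a i) (?b i)) = 0"
    using fin eq by (simp add: sum.Plus sum_negf)
  with V' have "(\<Sum>i\<in>I <+> J. \<beta> (?a i) (?b i)) = 0"
    using fin I J by (intro balanced_sum_eq_0[OF \<beta>]) auto
  moreover have "\<beta> (cscale (- 1) (a' i)) (b' i) = - \<beta> (a' i) (b' i)" if "i \<in> J" for i
  proof -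
    have "\<beta> (a' i + cscale (- 1) (a' i)) (b' i) = \<beta> (a' i) (b' i) + \<beta> (cscale (- 1) (a' i)) (b' i)"
      using \<beta> V' J that by (simp add: balanced_on_def)
    moreover have "a' i + cscale (- 1) (a' i) = 0"
      by (simp add: vec_eq_iff)
    ultimately show ?thesis
      using balanced_on_zero(1)[OF \<beta>] J that by (simp add: eq_neg_iff_add_eq_0 add.commute)
  qed
  ultimately show ?thesis
    using fin by (simp add: sum.Plus sum_negf)
qed

text \<open>All representations of one tensor give the same value, so the description defining
  \<open>tlift\<close> is met by whichever representation is at hand.\<close>

lemma tlift_sum_kron:
  assumes \<beta>: "balanced_on V W \<beta>" and ab: "\<And>k. k < N \<Longrightarrow> a k \<in> V" "\<And>k. k < N \<Longrightarrow> b k \<in> W"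
  shows "tlift V W \<beta> (\<Sum>k<N. kron (a k) (b k)) = (\<Sum>k<(N::nat). \<beta> (a k) (b k))"
  unfolding tlift_def
proof (rule the_equality)
  show "\<exists>(M::nat) a' b'. (\<forall>k<M. a' k \<in> V \<and> b' k \<in> W) \<and>
      (\<Sum>k<N. kron (a k) (b k)) = (\<Sum>k<M. kron (a' k) (b' k)) \<and>
      (\<Sum>k<N. \<beta> (a k) (b k)) = (\<Sum>k<M. \<beta> (a' k) (b' k))"
    using ab by (intro exI[of _ N] exI[of _ a] exI[of _ b]) simp
  fix Y assume "\<exists>(M::nat) a' b'. (\<forall>k<M. a' k \<in> V \<and> b' k \<in> W) \<and>
      (\<Sum>k<N. kron (a k) (b k)) = (\<Sum>k<M. kron (a' k) (b' k)) \<and>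
      Y = (\<Sum>k<M. \<beta> (a' k) (b' k))"
  then obtain M :: nat and a' b' where *: "\<And>k. k < M \<Longrightarrow> a' k \<in> V \<and> b' k \<in> W"
      "(\<Sum>k<N. kron (a k) (b k)) = (\<Sum>k<M. kron (a' k) (b' k))" "Y = (\<Sum>k<M. \<beta> (a' k) (b' k))"
    by blast
  then show "Y = (\<Sum>k<N. \<beta> (a k) (b k))"
    using balanced_sum_cong[OF \<beta> finite_lessThan[of N] finite_lessThan[of M], of a b a' b'] ab by auto
qed

lemma tlift_kron:
  assumes "balanced_on V W \<beta>" "a \<in> V" "b \<in> W"
  shows "tlift V W \<beta> (kron a b) = \<beta> a b"
  using tlift_sum_kron[OF assms(1), of 1 "\<lambda>_. a" "\<lambda>_. b"] assms by simp

lemma tensor_spaceE: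
  assumes "X \<in> tensor_space V W"
  obtains N :: nat and a b where "\<And>k. k < N \<Longrightarrow> a k \<in> V" "\<And>k. k < N \<Longrightarrow> b k \<in> W"
    "X = (\<Sum>k<N. kron (a k) (b k))"
  using assms by (auto simp: tensor_space_def)

lemma kron_in_tensor_space: "a \<in> V \<Longrightarrow> b \<in> W \<Longrightarrow> kron a b \<in> tensor_space V W"
  unfolding tensor_space_def
  by (intro CollectI exI[of _ 1] exI[of _ "\<lambda>_. a"] exI[of _ "\<lambda>_. b"]) simp

lemma sum_kron_in_tensor_space:
  assumes "finite I" "\<And>i. i \<in> I \<Longrightarrow> a i \<in> V" "\<And>i. i \<in> I \<Longrightarrow> b i \<in> W"
  shows "(\<Sum>i\<in>I. kron (a i) (b i)) \<in> tensor_space V W"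
proof -
  obtain h where h: "bij_betw h {..<card I} I"
    using ex_bij_betw_nat_finite[OF assms(1)] by (auto simp: lessThan_atLeast0)
  then have "(\<Sum>i\<in>I. kron (a i) (b i)) = (\<Sum>k<card I. kron (a (h k)) (b (h k)))"
    by (rule sum.reindex_bij_betw[symmetric])
  moreover have "h k \<in> I" if "k < card I" for k
    using h that by (auto simp: bij_betw_def)
  ultimately show ?thesis
    unfolding tensor_space_def using assms
    by (intro CollectI exI[of _ "card I"] exI[of _ "\<lambda>k. a (h k)"] exI[of _ "\<lambda>k. b (h k)"]) simp
qed

lemma tensor_space_add:
  assumes "X \<in> tensor_space V W" "Y \<in> tensor_space V W"
  shows "X + Y \<in> tensor_space V W"
proof -
  obtain N a b where X: "\<And>k. k < N \<Longrightarrow> a k \<in> V" "\<And>k. k < N \<Longrightarrow> b k \<in> W"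
    "X = (\<Sum>k<(N::nat). kron (a k) (b k))"
    using tensor_spaceE[OF assms(1)] by blast
  obtain M a' b' where Y: "\<And>k. k < M \<Longrightarrow> a' k \<in> V" "\<And>k. k < M \<Longrightarrow> b' k \<in> W"
    "Y = (\<Sum>k<(M::nat). kron (a' k) (b' k))"
    using tensor_spaceE[OF assms(2)] by blast
  have "(\<Sum>k\<in>{..<N} <+> {..<M}. kron (case_sum a a' k) (case_sum b b' k)) \<in> tensor_space V W"
    by (rule sum_kron_in_tensor_space) (use X Y in auto)
  then show ?thesis
    by (simp add: X(3) Y(3) sum.Plus)
qed

lemma csubspace_tensor_space: "csubspace (tensor_space V W)"
  unfolding csubspace_def
proof (intro conjI ballI allI)
  show "0 \<in> tensor_space V W"
    unfolding tensor_space_def by (intro CollectI exI[of _ 0]) simp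
  fix c X assume "X \<in> tensor_space V W"
  then obtain N a b where X: "\<And>k. k < N \<Longrightarrow> a k \<in> V" "\<And>k. k < N \<Longrightarrow> b k \<in> W"
    "X = (\<Sum>k<(N::nat). kron (a k) (b k))"
    using tensor_spaceE by blast
  then have "cscale c X = (\<Sum>k<N. kron (cscale c (a k)) (b k))"
    by (simp add: cscale_sum kron_simps)
  then show "cscale c X \<in> tensor_space V W"
    unfolding tensor_space_def using X V
    by (intro CollectI exI[of _ N] exI[of _ "\<lambda>k. cscale c (a k)"] exI[of _ b])
       (auto simp: csubspace_def)
qed (rule tensor_space_add)

lemma tlift_add:
  assumes \<beta>: "balanced_on V W \<beta>" and XY: "X \<in> tensor_space V W" "Y \<in> tensor_space V W"
  shows "tlift V W \<beta> (X + Y) = tlift V W \<beta> X + tlift V W \<beta> Y"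
proof -
  obtain N a b where X: "\<And>k. k < N \<Longrightarrow> a k \<in> V" "\<And>k. k < N \<Longrightarrow> b k \<in> W"
    "X = (\<Sum>k<(N::nat). kron (a k) (b k))"
    using tensor_spaceE[OF XY(1)] by blast
  obtain M a' b' where Y: "\<And>k. k < M \<Longrightarrow> a' k \<in> V" "\<And>k. k < M \<Longrightarrow> b' k \<in> W"
    "Y = (\<Sum>k<(M::nat). kron (a' k) (b' k))"
    using tensor_spaceE[OF XY(2)] by blast
  obtain K a'' b'' where Z: "\<And>k. k < K \<Longrightarrow> a'' k \<in> V" "\<And>k. k < K \<Longrightarrow> b'' k \<in> W"
    "X + Y = (\<Sum>k<(K::nat). kron (a'' k) (b'' k))"
    using tensor_spaceE[OF tensor_space_add[OF XY]] by blast
  have "(\<Sum>k<K. \<beta> (a'' k) (b'' k)) =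
      (\<Sum>k\<in>{..<N} <+> {..<M}. \<beta> (case_sum a a' k) (case_sum b b' k))"
    by (rule balanced_sum_cong[OF \<beta>])
       (use X Y Z in \<open>auto simp: sum.Plus\<close>)
  then have "(\<Sum>k<K. \<beta> (a'' k) (b'' k)) = (\<Sum>k<N. \<beta> (a k) (b k)) + (\<Sum>k<M. \<beta> (a' k) (b' k))"
    by (simp add: sum.Plus)
  then show ?thesis
    unfolding Z(3) unfolding X(3) Y(3) using X(1,2) Y(1,2) Z(1,2) \<beta>
    by (simp add: tlift_sum_kron)
qed

text \<open>The codomain of \<open>\<beta>\<close> is just an abelian group. Its scalar
  multiplication enters as the additive map \<open>\<phi>\<close>, so that codomains made of
  matrices of different sizes are covered at once.\<close>

lemma tlift_cscale:
  assumes \<beta>: "balanced_on V W \<beta>" and X: "X \<in> tensor_space V W"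
    and \<phi>: "\<And>a b. a \<in> V \<Longrightarrow> b \<in> W \<Longrightarrow> \<beta> (cscale c a) b = \<phi> (\<beta> a b)"
    and \<phi>_sum: "\<And>x y. \<phi> (x + y) = \<phi> x + \<phi> y" 
  shows "tlift V W \<beta> (cscale c X) = \<phi> (tlift V W \<beta> X)"
proof -
  obtain N a b where N: "\<And>k. k < N \<Longrightarrow> a k \<in> V" "\<And>k. k < N \<Longrightarrow> b k \<in> W"
    "X = (\<Sum>k<(N::nat). kron (a k) (b k))"
    using tensor_spaceE[OF X] by blast
  have ca: "cscale c (a k) \<in> V" if "k < N" for k
    using N that V by (auto simp: csubspace_def)
  have \<phi>0: "\<phi> 0 = 0"
    using \<phi>_sum[of 0 0] by simp
  have \<phi>_sum': "\<phi> (sum g I) = (\<Sum>i\<in>I. \<phi> (g i))" for g and I :: "nat set"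
    by (induction I rule: infinite_finite_induct) (simp_all add: \<phi>0 \<phi>_sum)
  have "tlift V W \<beta> (cscale c X) = tlift V W \<beta> (\<Sum>k<N. kron (cscale c (a k)) (b k))"
    by (simp add: N(3) cscale_sum kron_simps)
  then show ?thesis
    using N(1,2) ca by (simp add: N(3) tlift_sum_kron[OF \<beta>] \<phi> \<phi>_sum')
qed

end

subsection \<open>The GNS space\<close>

lemma unital_star_subalgebraD:
  assumes "unital_star_subalgebra B"
  shows "mat 1 \<in> B" "a \<in> B \<Longrightarrow> b \<in> B \<Longrightarrow> a + b \<in> B" "a \<in> B \<Longrightarrow> b \<in> B \<Longrightarrow> a ** b \<in> B"
    "a \<in> B \<Longrightarrow> cscale c a \<in> B" "a \<in> B \<Longrightarrow> cadj a \<in> B" "csubspace B"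
proof -
  have "cscale 0 (mat 1) \<in> B"
    using assms unfolding unital_star_subalgebra_def by blast
  then show "csubspace B"
    using assms by (auto simp: unital_star_subalgebra_def csubspace_def)
qed (use assms in \<open>auto simp: unital_star_subalgebra_def\<close>)

lemma peval_in:
  assumes "unital_star_subalgebra B" "q \<in> B"
  shows "peval q p \<in> B"
proof (induction p)
  case 0
  show ?case
    using unital_star_subalgebraD(6)[OF assms(1)] by (simp add: csubspace_def)
qed (use assms in \<open>simp add: unital_star_subalgebraD\<close>)

section \<open>Matrix blocks and their trace\<close>

lemma block_star_iso_sum:
  assumes "block_star_iso B r d \<pi>" "csubspace B" "\<And>t. t \<in> T \<Longrightarrow> g t \<in> B"
  shows "\<pi> (sum g T) k i j = (\<Sum>t\<in>T. \<pi> (g t) k i j)"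
proof -
  have \<pi>0: "\<pi> 0 k i j = 0"
  proof -
    have "0 \<in> B"
      using assms(2) by (simp add: csubspace_def)
    then have "\<pi> (cscale 0 0) k i j = 0 * \<pi> 0 k i j"
      using assms(1) unfolding block_star_iso_def by blast
    then show ?thesis
      by simp
  qed
  from assms(3) show ?thesis
  proof (induction T rule: infinite_finite_induct)
    case (insert t T)
    then have "sum g T \<in> B"
      using csubspace_sum[OF assms(2)] by blast
    with insert assms(1) show ?case
      by (simp add: block_star_iso_def)
  qed (use \<pi>0 in auto)
qed

text \<open>The frame is the family of matrix units pulled back along \<open>\<pi>\<close>. Pairing
  with the unit at \<open>(k, i, j)\<close> through the trace reads off the entry
  \<open>\<pi> c k i j\<close>.\<close>

lemma block_trace_frame:
  assumes "block_trace B Tr" and B: "unital_star_subalgebra B"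
  obtains N :: nat and h where "\<And>k. k < N \<Longrightarrow> h k \<in> B"
    "\<And>c. c \<in> B \<Longrightarrow> (\<Sum>k<N. cscale (Tr (cadj (h k) ** c)) (h k)) = c"
proof -
  obtain r d \<pi> where iso: "block_star_iso B r d \<pi>"
    and Tr: "\<And>a. a \<in> B \<Longrightarrow> Tr a = (\<Sum>k<r. \<Sum>i<d k. \<pi> a k i i)"
    using assms(1) by (auto simp: block_trace_def)
  note Bs = unital_star_subalgebraD[OF B]
  have bij: "bij_betw \<pi> B (block_families r d)"
    and mult: "\<And>a b k i j. a \<in> B \<Longrightarrow> b \<in> B \<Longrightarrow> \<pi> (a ** b) k i j = (\<Sum>l<d k. \<pi> a k i l * \<pi> b k l j)"
    and scale: "\<And>c a k i j. a \<in> B \<Longrightarrow> \<pi> (cscale c a) k i j = c * \<pi> a k i j"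
    and adj: "\<And>a k i j. a \<in> B \<Longrightarrow> \<pi> (cadj a) k i j = cnj (\<pi> a k j i)"
    using iso by (auto simp: block_star_iso_def)
  define T where "T = Sigma {..<r} (\<lambda>k. {..<d k} \<times> {..<d k})"
  define u :: "nat \<times> nat \<times> nat \<Rightarrow> nat \<Rightarrow> nat \<Rightarrow> nat \<Rightarrow> complex"
    where "u t k i j = (if t = (k, i, j) then 1 else 0)" for t k i j
  define E where "E t = inv_into B \<pi> (u t)" for t
  have "u t \<in> \<pi> ` B" if "t \<in> T" for t
    using that bij by (auto simp: bij_betw_def block_families_def u_def T_def)
  then have E: "E t \<in> B" "\<pi> (E t) = u t" if "t \<in> T" for t
    using that unfolding E_def by (simp_all add: inv_into_into f_inv_into_f)
  have fin: "finite T"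
    by (simp add: T_def)
  have coeff: "Tr (cadj (E (k, i, j)) ** c) = \<pi> c k i j" if "c \<in> B" "(k, i, j) \<in> T" for c k i j
  proof -
    have "Tr (cadj (E (k, i, j)) ** c) = (\<Sum>k'<r. \<Sum>i'<d k'. \<Sum>l<d k'. cnj (u (k, i, j) k' l i') * \<pi> c k' l i')"
      using that E Bs by (simp add: Tr mult adj)
    also have "\<dots> = (\<Sum>k'<r. if k' = k then \<pi> c k i j else 0)"
    proof (rule sum.cong[OF refl])
      fix k'
      have "(\<Sum>l<d k'. cnj (u (k, i, j) k' l i') * \<pi> c k' l i') =
          (\<Sum>l<d k'. if l = i then if i' = j \<and> k' = k then \<pi> c k i j else 0 else 0)" for i'
        by (rule sum.cong) (auto simp: u_def)
      then show "(\<Sum>i'<d k'. \<Sum>l<d k'. cnj (u (k, i, j) k' l i') * \<pi> c k' l i') =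
          (if k' = k then \<pi> c k i j else 0)"
        using that(2) by (cases "k' = k") (simp_all add: T_def cong: if_cong)
    qed
    also have "\<dots> = \<pi> c k i j"
      using that(2) by (simp add: T_def)
    finally show ?thesis .
  qed
  have frame: "(\<Sum>t\<in>T. cscale (Tr (cadj (E t) ** c)) (E t)) = c" if c: "c \<in> B" for c
  proof -
    let ?s = "\<Sum>t\<in>T. cscale (Tr (cadj (E t) ** c)) (E t)"
    have sB: "?s \<in> B"
      using E Bs by (intro csubspace_sum) auto
    have "\<pi> ?s k i j = \<pi> c k i j" for k i j
    proof -
      have "\<pi> ?s k i j = (\<Sum>t\<in>T. Tr (cadj (E t) ** c) * u t k i j)"
        using E Bs by (subst block_star_iso_sum[OF iso]) (auto simp: scale)
      also have "\<dots> = (\<Sum>t\<in>T. if t = (k, i, j) then \<pi> c k i j else 0)"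
        using coeff[OF c] by (intro sum.cong) (auto simp: u_def)
      also have "\<dots> = (if (k, i, j) \<in> T then \<pi> c k i j else 0)"
        using fin by simp
      \<comment> \<open>Outside \<open>T\<close> both sides are 0, because
        \<open>block_families\<close> forces the entries beyond the blocks to vanish.\<close>
      also have "\<dots> = \<pi> c k i j"
      proof -
        have "\<pi> c \<in> block_families r d"
          using bij c by (auto simp: bij_betw_def)
        then show ?thesis
          unfolding block_families_def T_def by auto
      qed
      finally show ?thesis .
    qed
    then have "\<pi> ?s = \<pi> c"
      by (intro ext)
    then show ?thesis
      using bij sB c by (auto simp: bij_betw_def inj_on_def)
  qed
  obtain g where g: "bij_betw g {..<card T} T"
    using ex_bij_betw_nat_finite[OF fin] by (auto simp: lessThan_atLeast0)
  show thesis
  proof (rule that[of "card T" "E \<circ> g"])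
    show "(E \<circ> g) k \<in> B" if "k < card T" for k
      using E(1)[of "g k"] bij_betwE[OF g] that by simp
    show "(\<Sum>k<card T. cscale (Tr (cadj ((E \<circ> g) k) ** c)) ((E \<circ> g) k)) = c" if "c \<in> B" for c
      using sum.reindex_bij_betw[OF g, of "\<lambda>t. cscale (Tr (cadj (E t) ** c)) (E t)"] frame[OF that]
      by simp
  qed
qed

lemma
  assumes "block_trace B Tr" and B: "unital_star_subalgebra B"
  shows block_trace_commute: "a \<in> B \<Longrightarrow> b \<in> B \<Longrightarrow> Tr (a ** b) = Tr (b ** a)"
    and block_trace_cadj: "a \<in> B \<Longrightarrow> Tr (cadj a) = cnj (Tr a)"
proof -
  obtain r d \<pi> where iso: "block_star_iso B r d \<pi>"
    and Tr: "\<And>a. a \<in> B \<Longrightarrow> Tr a = (\<Sum>k<r. \<Sum>i<d k. \<pi> a k i i)"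
    using assms(1) by (auto simp: block_trace_def)
  note Bs = unital_star_subalgebraD[OF B]
  have mult: "\<And>a b k i j. a \<in> B \<Longrightarrow> b \<in> B \<Longrightarrow> \<pi> (a ** b) k i j = (\<Sum>l<d k. \<pi> a k i l * \<pi> b k l j)"
    and adj: "\<And>a k i j. a \<in> B \<Longrightarrow> \<pi> (cadj a) k i j = cnj (\<pi> a k j i)"
    using iso by (auto simp: block_star_iso_def)
  show "Tr (a ** b) = Tr (b ** a)" if "a \<in> B" "b \<in> B"
  proof -
    have "Tr (a ** b) = (\<Sum>k<r. \<Sum>i<d k. \<Sum>l<d k. \<pi> a k i l * \<pi> b k l i)"
      using that Bs by (simp add: Tr mult)
    also have "\<dots> = (\<Sum>k<r. \<Sum>l<d k. \<Sum>i<d k. \<pi> b k l i * \<pi> a k i l)"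
      by (rule sum.cong[OF refl], subst sum.swap) (simp add: mult.commute)
    also have "\<dots> = Tr (b ** a)"
      using that Bs by (simp add: Tr mult)
    finally show ?thesis .
  qed
  show "Tr (cadj a) = cnj (Tr a)" if "a \<in> B"
    using that Bs by (simp add: Tr adj)
qed

text \<open>\<open>R\<close> and \<open>S\<close> stand for \<open>Q\<^sup>1\<^sup>/\<^sup>2\<close> and \<open>Q\<^sup>-\<^sup>1\<^sup>/\<^sup>2\<close>; \<open>h\<close> is a Parseval frame of \<open>L\<^sup>2(B)\<close>.\<close>

locale gns_frame =
  fixes B :: "(complex ^ 'n ^ 'n) set" and \<psi> :: "complex ^ 'n ^ 'n \<Rightarrow> complex"
    and R S :: "complex ^ 'n ^ 'n" and N :: nat and h :: "nat \<Rightarrow> complex ^ 'n ^ 'n"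
  assumes B: "unital_star_subalgebra B"
    and \<psi>: "linear_on_alg B \<psi>"
    and gns_cnj: "a \<in> B \<Longrightarrow> b \<in> B \<Longrightarrow> cnj (gns \<psi> a b) = gns \<psi> b a"
    and kms: "a \<in> B \<Longrightarrow> b \<in> B \<Longrightarrow> \<psi> (a ** b) = \<psi> (b ** (R ** R ** a ** S ** S))"
    and RS_in: "R \<in> B" "S \<in> B"
    and RS: "R ** S = mat 1" "S ** R = mat 1"
    and cadj_RS: "cadj R = R" "cadj S = S"
    and h_in: "k < N \<Longrightarrow> h k \<in> B"
    and frame: "c \<in> B \<Longrightarrow> (\<Sum>k<N. cscale (gns \<psi> (h k) c) (h k)) = c"

sublocale gns_frame \<subseteq> tensor_pair B B
  using unital_star_subalgebraD[OF B] by unfold_locales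

context gns_frame
begin

lemmas B_intros [simp, intro] = unital_star_subalgebraD(1-5)[OF B]

lemma sum_in: "(\<And>i. i \<in> I \<Longrightarrow> g i \<in> B) \<Longrightarrow> sum g I \<in> B"
  using csubspace_sum[OF V] by blast

lemma \<psi>_add: "a \<in> B \<Longrightarrow> b \<in> B \<Longrightarrow> \<psi> (a + b) = \<psi> a + \<psi> b"
  and \<psi>_cscale: "a \<in> B \<Longrightarrow> \<psi> (cscale c a) = c * \<psi> a"
  using \<psi> by (simp_all add: linear_on_alg_def)

lemma \<psi>_sum: "(\<And>i. i \<in> I \<Longrightarrow> g i \<in> B) \<Longrightarrow> \<psi> (sum g I) = (\<Sum>i\<in>I. \<psi> (g i))"
proof (induction I rule: infinite_finite_induct)
  case (infinite I)
  then show ?case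
    using \<psi>_cscale[of "mat 1" 0] by simp
next
  case empty
  show ?case
    using \<psi>_cscale[of "mat 1" 0] by simp
next
  case (insert i I)
  then show ?case
    using sum_in[of I g] by (simp add: \<psi>_add)
qed

lemma gns_add_right: "a \<in> B \<Longrightarrow> b \<in> B \<Longrightarrow> b' \<in> B \<Longrightarrow> gns \<psi> a (b + b') = gns \<psi> a b + gns \<psi> a b'"
  and gns_cscale_right: "a \<in> B \<Longrightarrow> b \<in> B \<Longrightarrow> gns \<psi> a (cscale c b) = c * gns \<psi> a b"
  by (simp_all add: gns_def matrix_mult_add_rdistrib matrix_add_ldistrib cscale_matrix_mult
    matrix_mult_cscale \<psi>_add \<psi>_cscale)

lemma gns_sum_right:
  "a \<in> B \<Longrightarrow> (\<And>i. i \<in> I \<Longrightarrow> g i \<in> B) \<Longrightarrow> gns \<psi> a (sum g I) = (\<Sum>i\<in>I. gns \<psi> a (g i))"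
  by (simp add: gns_def matrix_mult_sum_right \<psi>_sum)

lemma gns_sum_left:
  "b \<in> B \<Longrightarrow> (\<And>i. i \<in> I \<Longrightarrow> g i \<in> B) \<Longrightarrow> gns \<psi> (sum g I) b = (\<Sum>i\<in>I. gns \<psi> (g i) b)"
  by (simp add: gns_def cadj_sum matrix_mult_sum_left \<psi>_sum)

lemma gns_mult_left: "gns \<psi> (a ** b) c = gns \<psi> b (cadj a ** c)"
  by (simp add: gns_def matrix_mul_assoc)

lemma frame_cadj: "c \<in> B \<Longrightarrow> (\<Sum>k<N. cscale (gns \<psi> c (h k)) (cadj (h k))) = cadj c"
  using arg_cong[OF frame[of c], of cadj] by (simp add: cadj_sum gns_cnj h_in)

section \<open>Multiplication, inner product and adjoints on the tensor square\<close>

lemma balanced_kron: "balanced_on B B (\<lambda>a b. kron (F a) (G b))"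
  if "\<And>a b. a \<in> B \<Longrightarrow> b \<in> B \<Longrightarrow> F (a + b) = F a + F b" "\<And>c a. a \<in> B \<Longrightarrow> F (cscale c a) = cscale c (F a)"
    "\<And>a b. a \<in> B \<Longrightarrow> b \<in> B \<Longrightarrow> G (a + b) = G a + G b" "\<And>c a. a \<in> B \<Longrightarrow> G (cscale c a) = cscale c (G a)"
  for F :: "complex ^ 'n ^ 'n \<Rightarrow> complex ^ 'k ^ 'k" and G :: "complex ^ 'n ^ 'n \<Rightarrow> complex ^ 'l ^ 'l"
  by (rule balanced_onI) (simp_all add: that kron_simps)

lemma balanced_mult: "balanced_on B B (\<lambda>a b. a ** b)"
  by (rule balanced_onI)
     (simp_all add: matrix_mult_add_rdistrib matrix_add_ldistrib cscale_matrix_mult matrix_mult_cscale)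

lemma mult_map_sum_kron:
  assumes "\<And>k. k < M \<Longrightarrow> a k \<in> B" "\<And>k. k < M \<Longrightarrow> b k \<in> B"
  shows "mult_map B (\<Sum>k<(M::nat). kron (a k) (b k)) = (\<Sum>k<M. a k ** b k)"
  unfolding mult_map_def using assms by (rule tlift_sum_kron[OF balanced_mult])

lemma mult_map_kron: "a \<in> B \<Longrightarrow> b \<in> B \<Longrightarrow> mult_map B (kron a b) = a ** b"
  unfolding mult_map_def by (rule tlift_kron[OF balanced_mult])

text \<open>Two nested lifts require two bilinearity checks. The inner functional is antilinear in
  the fixed pair \<open>x\<close>, \<open>y\<close>; conjugation, with \<open>gns_cnj\<close>, makes
  it linear there, so that the outer lift is legitimate.\<close>

lemma tensor_ip_sum_kron:
  assumes ab: "\<And>k. k < M \<Longrightarrow> a k \<in> B" "\<And>k. k < M \<Longrightarrow> b k \<in> B"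
    and cd: "\<And>k. k < L \<Longrightarrow> c k \<in> B" "\<And>k. k < L \<Longrightarrow> d k \<in> B"
  shows "tensor_ip B B (gns \<psi>) (gns \<psi>) (\<Sum>k<(M::nat). kron (a k) (b k)) (\<Sum>j<(L::nat). kron (c j) (d j)) =
    (\<Sum>j<L. \<Sum>k<M. gns \<psi> (a k) (c j) * gns \<psi> (b k) (d j))"
proof -
  let ?X = "\<Sum>k<M. kron (a k) (b k)"
  have bal: "balanced_on B B (\<lambda>a b. gns \<psi> x a * gns \<psi> y b)" if "x \<in> B" "y \<in> B" for x y
    by (rule balanced_onI) (use that in \<open>simp_all add: gns_add_right gns_cscale_right algebra_simps\<close>)
  have inner: "cnj (tlift B B (\<lambda>a b. gns \<psi> x a * gns \<psi> y b) ?X) =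
      (\<Sum>k<M. gns \<psi> (a k) x * gns \<psi> (b k) y)" if "x \<in> B" "y \<in> B" for x y
    using that ab by (subst tlift_sum_kron[OF bal[OF that]]) (auto simp: gns_cnj)
  have "balanced_on B B (\<lambda>x y. cnj (tlift B B (\<lambda>a b. gns \<psi> x a * gns \<psi> y b) ?X))"
    by (rule balanced_onI, simp_all add: inner)
       (simp_all add: ab gns_add_right gns_cscale_right algebra_simps sum.distrib)
  then show ?thesis
    unfolding tensor_ip_def using cd by (subst tlift_sum_kron) (auto simp: inner)
qed

text \<open>The products \<open>kron (h i) (h j)\<close> form a frame of the tensor square, so a
  tensor is recovered from its pairings with them. This is the uniqueness half of the adjoint of
  multiplication.\<close>

lemma tensor_ip_nondegenerate:
  assumes X: "X \<in> tensor_space B B" and Y: "Y \<in> tensor_space B B"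
    and eq: "\<And>Z. Z \<in> tensor_space B B \<Longrightarrow>
      tensor_ip B B (gns \<psi>) (gns \<psi>) Z X = tensor_ip B B (gns \<psi>) (gns \<psi>) Z Y"
  shows "X = Y"
proof -
  have expand: "Z = (\<Sum>i<N. \<Sum>j<N. cscale (tensor_ip B B (gns \<psi>) (gns \<psi>) (kron (h i) (h j)) Z) (kron (h i) (h j)))"
    if Z: "Z \<in> tensor_space B B" for Z
  proof -
    obtain M a b where ab: "\<And>k. k < M \<Longrightarrow> a k \<in> B" "\<And>k. k < M \<Longrightarrow> b k \<in> B"
      "Z = (\<Sum>k<(M::nat). kron (a k) (b k))"
      using tensor_spaceE[OF Z] by blast
    have ip: "tensor_ip B B (gns \<psi>) (gns \<psi>) (kron (h i) (h j)) Z =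
        (\<Sum>k<M. gns \<psi> (h i) (a k) * gns \<psi> (h j) (b k))" if "i < N" "j < N" for i j
      using tensor_ip_sum_kron[of 1 "\<lambda>_. h i" "\<lambda>_. h j" M a b] that ab h_in by simp
    have "Z = (\<Sum>k<M. kron (\<Sum>i<N. cscale (gns \<psi> (h i) (a k)) (h i)) (\<Sum>j<N. cscale (gns \<psi> (h j) (b k)) (h j)))"
      using ab by (simp add: frame)
    also have "\<dots> = (\<Sum>k<M. \<Sum>i<N. \<Sum>j<N. cscale (gns \<psi> (h i) (a k) * gns \<psi> (h j) (b k)) (kron (h i) (h j)))"
      by (simp only: kron_sum_left) (simp add: kron_sum_right kron_simps mult.commute)
    also have "\<dots> = (\<Sum>i<N. \<Sum>k<M. \<Sum>j<N. cscale (gns \<psi> (h i) (a k) * gns \<psi> (h j) (b k)) (kron (h i) (h j)))"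
      by (rule sum.swap)
    also have "\<dots> = (\<Sum>i<N. \<Sum>j<N. \<Sum>k<M. cscale (gns \<psi> (h i) (a k) * gns \<psi> (h j) (b k)) (kron (h i) (h j)))"
      by (intro sum.cong refl sum.swap)
    also have "\<dots> = (\<Sum>i<N. \<Sum>j<N. cscale (tensor_ip B B (gns \<psi>) (gns \<psi>) (kron (h i) (h j)) Z) (kron (h i) (h j)))"
      by (intro sum.cong refl) (simp add: ip cscale_left_sum)
    finally show ?thesis .
  qed
  have "tensor_ip B B (gns \<psi>) (gns \<psi>) (kron (h i) (h j)) X = tensor_ip B B (gns \<psi>) (gns \<psi>) (kron (h i) (h j)) Y"
    if "i < N" "j < N" for i j
    using eq kron_in_tensor_space h_in that by blast
  then have "(\<Sum>i<N. \<Sum>j<N. cscale (tensor_ip B B (gns \<psi>) (gns \<psi>) (kron (h i) (h j)) X) (kron (h i) (h j))) =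
      (\<Sum>i<N. \<Sum>j<N. cscale (tensor_ip B B (gns \<psi>) (gns \<psi>) (kron (h i) (h j)) Y) (kron (h i) (h j)))"
    by (intro sum.cong refl) simp
  from trans[OF expand[OF X] trans[OF this expand[OF Y, symmetric]]] show ?thesis .
qed

text \<open>Pairing \<open>x ** y\<close> with \<open>a\<close> equals pairing \<open>y\<close> with
  \<open>cadj x ** a\<close>. Expanding \<open>cadj x\<close> along the adjoint frame elements then
  separates \<open>x\<close> from \<open>y\<close>, which exhibits the functional as pairing with
  the claimed tensor.\<close>

lemma mult_adj_eq:
  assumes a: "a \<in> B"
  shows "mult_adj B \<psi> a = (\<Sum>k<N. kron (h k) (cadj (h k) ** a))"
  unfolding mult_adj_def hadjoint_def
proof (rule the_equality)
  let ?m = "\<Sum>k<N. kron (h k) (cadj (h k) ** a)"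
  have m: "?m \<in> tensor_space B B"
    using a h_in by (intro sum_kron_in_tensor_space) auto
  have adj: "gns \<psi> (mult_map B Z) a = tensor_ip B B (gns \<psi>) (gns \<psi>) Z ?m" if Z: "Z \<in> tensor_space B B" for Z
  proof -
    obtain M x y where xy: "\<And>k. k < M \<Longrightarrow> x k \<in> B" "\<And>k. k < M \<Longrightarrow> y k \<in> B"
      "Z = (\<Sum>k<(M::nat). kron (x k) (y k))"
      using tensor_spaceE[OF Z] by blast
    have *: "gns \<psi> (y k) (cadj (x k) ** a) = (\<Sum>j<N. gns \<psi> (x k) (h j) * gns \<psi> (y k) (cadj (h j) ** a))"
      if "k < M" for k
    proof -
      have "cadj (x k) ** a = (\<Sum>j<N. cscale (gns \<psi> (x k) (h j)) (cadj (h j) ** a))"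
        using frame_cadj[of "x k"] xy that by (simp flip: cscale_matrix_mult matrix_mult_sum_left)
      then show ?thesis
        using xy that a h_in by (subst \<open>cadj (x k) ** a = _\<close>, subst gns_sum_right) (auto simp: gns_cscale_right)
    qed
    have "gns \<psi> (mult_map B Z) a = (\<Sum>k<M. gns \<psi> (x k ** y k) a)"
      using xy a by (subst gns_sum_left[symmetric]) (auto simp: mult_map_sum_kron)
    also have "\<dots> = (\<Sum>k<M. \<Sum>j<N. gns \<psi> (x k) (h j) * gns \<psi> (y k) (cadj (h j) ** a))"
      using * by (simp add: gns_mult_left)
    also have "\<dots> = (\<Sum>j<N. \<Sum>k<M. gns \<psi> (x k) (h j) * gns \<psi> (y k) (cadj (h j) ** a))"
      by (rule sum.swap)
    also have "\<dots> = tensor_ip B B (gns \<psi>) (gns \<psi>) Z ?m"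
      unfolding xy(3) by (rule tensor_ip_sum_kron[symmetric]) (use xy a h_in in auto)
    finally show ?thesis .
  qed
  show "?m \<in> tensor_space B B \<and>
      (\<forall>Z\<in>tensor_space B B. gns \<psi> (mult_map B Z) a = tensor_ip B B (gns \<psi>) (gns \<psi>) Z ?m)"
    using m adj by blast
  fix X assume X: "X \<in> tensor_space B B \<and>
      (\<forall>Z\<in>tensor_space B B. gns \<psi> (mult_map B Z) a = tensor_ip B B (gns \<psi>) (gns \<psi>) Z X)"
  show "X = ?m"
  proof (rule tensor_ip_nondegenerate)
    show "X \<in> tensor_space B B"
      using X by blast
    show "tensor_ip B B (gns \<psi>) (gns \<psi>) Z X = tensor_ip B B (gns \<psi>) (gns \<psi>) Z ?m"
      if "Z \<in> tensor_space B B" for Z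
      using X adj[OF that] that by simp
  qed (rule m)
qed

lemma unit_adj_eq:
  assumes "a \<in> B"
  shows "unit_adj \<psi> a = \<psi> a"
proof -
  have 1: "gns \<psi> (unit_map z) a = cnj z * \<psi> a" for z
    using assms by (simp add: unit_map_def gns_def cscale_matrix_mult \<psi>_cscale)
  show ?thesis
    unfolding unit_adj_def hadjoint_def 1
  proof (rule the_equality)
    fix x assume x: "x \<in> UNIV \<and> (\<forall>z\<in>UNIV. cnj z * \<psi> a = cnj z * x)"
    show "x = \<psi> a"
      using conjunct2[OF x, rule_format, of 1] by simp
  qed simp
qed

end

subsection \<open>The action on vectors\<close>

definition unvec :: "complex ^ ('n \<times> 'n) \<Rightarrow> complex ^ 'n ^ 'n" where
  "unvec v = (\<chi> i j. v $ (i, j))"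

lemma unvec_nth [simp]: "unvec v $ i $ j = v $ (i, j)"
  by (simp add: unvec_def)

lemma unvec_eq_0_iff: "unvec v = 0 \<longleftrightarrow> v = 0"
  by (auto simp: vec_eq_iff)

lemma unvec_sum: "unvec (sum g I) = (\<Sum>i\<in>I. unvec (g i))"
  by (simp add: vec_eq_iff)

text \<open>\<open>unvec\<close> identifies \<open>vtensor \<xi> (vbar \<eta>)\<close> with \<open>|\<xi>\<rangle>\<langle>\<eta>|\<close>, which turns the action of \<open>B \<otimes> B\<^sup>o\<^sup>p\<close> into
  two-sided multiplication.\<close>

lemma unvec_kron_transpose: "unvec (kron a (transpose b) *v v) = a ** unvec v ** b"
proof -
  have "(kron a (transpose b) *v v) $ (i, j) = (a ** unvec v ** b) $ i $ j" for i j
  proof -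
    have "(kron a (transpose b) *v v) $ (i, j) = (\<Sum>k\<in>UNIV. \<Sum>l\<in>UNIV. a $ i $ k * b $ l $ j * v $ (k, l))"
      by (simp add: matrix_vector_mult_def transpose_def sum.cartesian_product UNIV_Times_UNIV case_prod_beta)
    also have "\<dots> = (\<Sum>l\<in>UNIV. \<Sum>k\<in>UNIV. a $ i $ k * b $ l $ j * v $ (k, l))"
      by (rule sum.swap)
    also have "\<dots> = (a ** unvec v ** b) $ i $ j"
      by (simp add: matrix_matrix_mult_def sum_distrib_left sum_distrib_right mult_ac)
    finally show ?thesis .
  qed
  then show ?thesis
    by (simp add: vec_eq_iff)
qed

lemma sum_matrix_vector_mult: "(\<Sum>i\<in>I. g i) *v v = (\<Sum>i\<in>I. g i *v (v :: complex ^ 'n))"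
  by (induction I rule: infinite_finite_induct) (simp_all add: matrix_vector_mult_add_rdistrib)

text \<open>Expanding \<open>axis k 1\<close> in the basis and reading off coordinate
  \<open>i\<close> gives the completeness relation. Spanning is part of the definition, so the index
  type \<open>'j\<close> need not be compared with \<open>'n\<close>.\<close>

lemma orthonormal_basis_resolution:
  assumes "orthonormal_basis f"
  shows "(\<Sum>j\<in>UNIV. f j $ i * cnj (f j $ k)) = (if i = k then 1 else 0)"
proof -
  obtain c where c: "axis k 1 = (\<Sum>j\<in>UNIV. c j *s f j)"
    using assms unfolding orthonormal_basis_def by blast
  have "cinner (f l) (\<Sum>j\<in>J. c j *s f j) = (\<Sum>j\<in>J. c j * cinner (f l) (f j))" for l J
    by (induction J rule: infinite_finite_induct) (simp_all add: cinner_add_right cinner_scale_right)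
  then have "cinner (f l) (axis k 1) = (\<Sum>j\<in>UNIV. c j * cinner (f l) (f j))" for l
    using c by simp
  moreover have "cinner (f l) (f j) = (if l = j then 1 else 0)" for l j
    using assms by (simp add: orthonormal_basis_def)
  ultimately have "cinner (f l) (axis k 1) = c l" for l
    by (simp add: if_distrib cong: if_cong)
  moreover have "cinner (f l) (axis k 1) = cnj (f l $ k)" for l
    by (simp add: cinner_def axis_def if_distrib cong: if_cong)
  ultimately have "axis k 1 = (\<Sum>j\<in>UNIV. cnj (f j $ k) *s f j)"
    using c by simp
  then have "axis k 1 $ i = (\<Sum>j\<in>UNIV. cnj (f j $ k) *s f j) $ i"
    by simp
  then show ?thesis
    by (simp add: axis_def mult.commute)
qed

text \<open>By completeness the results do not depend on the basis. For \<open>M\<close>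
  self-adjoint the two vectors coincide, which is how \<open>u0\<close> and \<open>u1\<close> turn
  out to be the same vector.\<close>

lemma
  assumes "orthonormal_basis f"
  shows unvec_sum_vtensor_right: "unvec (\<Sum>j\<in>UNIV. vtensor (f j) (vbar (M *v f j))) = cadj M" (is ?r)
    and unvec_sum_vtensor_left: "unvec (\<Sum>j\<in>UNIV. vtensor (M *v f j) (vbar (f j))) = M" (is ?l)
proof -
  note res = orthonormal_basis_resolution[OF assms]
  have "(\<Sum>j\<in>UNIV. f j $ i * cnj (\<Sum>l\<in>UNIV. M $ k $ l * f j $ l)) = cnj (M $ k $ i)" for i k
  proof -
    have "(\<Sum>j\<in>UNIV. f j $ i * cnj (\<Sum>l\<in>UNIV. M $ k $ l * f j $ l)) =
        (\<Sum>l\<in>UNIV. cnj (M $ k $ l) * (\<Sum>j\<in>UNIV. f j $ i * cnj (f j $ l)))"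
      by (simp add: sum_distrib_left, subst sum.swap) (simp add: mult_ac)
    then show ?thesis
      by (simp add: res if_distrib cong: if_cong)
  qed
  then show ?r
    by (simp add: vec_eq_iff vtensor_def vbar_def matrix_vector_mult_def)
  have "(\<Sum>j\<in>UNIV. (\<Sum>l\<in>UNIV. M $ i $ l * f j $ l) * cnj (f j $ k)) = M $ i $ k" for i k
  proof -
    have "(\<Sum>j\<in>UNIV. (\<Sum>l\<in>UNIV. M $ i $ l * f j $ l) * cnj (f j $ k)) =
        (\<Sum>l\<in>UNIV. M $ i $ l * (\<Sum>j\<in>UNIV. f j $ l * cnj (f j $ k)))"
      by (simp add: sum_distrib_left sum_distrib_right, subst sum.swap) (simp add: mult_ac)
    then show ?thesis
      by (simp add: res if_distrib cong: if_cong)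
  qed
  then show ?l
    by (simp add: vec_eq_iff vtensor_def vbar_def matrix_vector_mult_def)
qed

text \<open>The orthogonal complement of a range is the kernel of the adjoint. This brings (3) into
  the form of (2), with the adjoint of \<open>e\<close> in place of \<open>e\<close>.\<close>

lemma range_orthogonal_iff:
  "(\<forall>v\<in>range (\<lambda>v. E *v v). cinner v u = 0) \<longleftrightarrow> cadj E *v u = 0"
proof -
  have *: "cinner (E *v v) u = cinner v (cadj E *v u)" for v
    by (metis cinner_cadj cadj_simps(1))
  show ?thesis
    unfolding ball_simps * by (metis UNIV_I cinner_self_eq_0_iff cinner_zero(1))
qed

context gns_frame
begin

lemma mult_left_eq_0_iff: "R ** M = 0 \<longleftrightarrow> M = 0" "S ** M = 0 \<longleftrightarrow> M = 0"
  by (metis RS matrix_mul_assoc matrix_mul_lid times0_right)+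

lemma mult_right_eq_0_iff: "M ** R = 0 \<longleftrightarrow> M = 0" "M ** S = 0 \<longleftrightarrow> M = 0"
  by (metis RS matrix_mul_assoc matrix_mul_rid times0_left)+

lemma bop_action_sum_kron:
  assumes "\<And>k. k < M \<Longrightarrow> x k \<in> B" "\<And>k. k < M \<Longrightarrow> y k \<in> B"
  shows "bop_action B (\<Sum>k<(M::nat). kron (x k) (y k)) = (\<Sum>k<M. kron (x k) (transpose (y k)))"
  unfolding bop_action_def using assms
  by (intro tlift_sum_kron[OF balanced_kron]) (auto simp: vec_eq_iff transpose_def)

lemma op_tensor_sum_kron:
  assumes "operator_on B F" "operator_on B G" "\<And>k. k < M \<Longrightarrow> x k \<in> B" "\<And>k. k < M \<Longrightarrow> y k \<in> B"
  shows "op_tensor B B F G (\<Sum>k<(M::nat). kron (x k) (y k)) = (\<Sum>k<M. kron (F (x k)) (G (y k)))"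
  unfolding op_tensor_def using assms
  by (intro tlift_sum_kron[OF balanced_kron]) (auto simp: operator_on_def)

lemma operator_on_id: "operator_on B (\<lambda>x. x)"
  by (simp add: operator_on_def)

lemma operator_on_two_sided: "a \<in> B \<Longrightarrow> b \<in> B \<Longrightarrow> operator_on B (\<lambda>x. a ** x ** b)"
  by (simp add: operator_on_def matrix_add_ldistrib matrix_mult_add_rdistrib cscale_matrix_mult
    matrix_mult_cscale)

lemma operator_on_sum:
  assumes "operator_on B F" "\<And>i. i \<in> I \<Longrightarrow> g i \<in> B"
  shows "F (sum g I) = (\<Sum>i\<in>I. F (g i))"
proof -
  have "F (cscale 0 (mat 1)) = cscale 0 (F (mat 1))"
    using assms(1) unital_star_subalgebraD(1)[OF B] unfolding operator_on_def by blast
  then have 0: "F 0 = 0"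
    by simp
  from assms(2) show ?thesis
  proof (induction I rule: infinite_finite_induct)
    case (insert i I)
    then show ?case
      using assms(1) sum_in[of I g] by (simp add: operator_on_def)
  qed (use 0 in auto)
qed

section \<open>The two multiplication conditions and undirectedness\<close>

lemma operator_frame:
  assumes F: "operator_on B F" and c: "c \<in> B"
  shows "F c = (\<Sum>k<N. cscale (gns \<psi> (h k) c) (F (h k)))"
proof -
  have "F c = F (\<Sum>k<N. cscale (gns \<psi> (h k) c) (h k))"
    using frame[OF c] by simp
  also have "\<dots> = (\<Sum>k<N. cscale (gns \<psi> (h k) c) (F (h k)))"
    using F h_in by (subst operator_on_sum[OF F]) (auto simp: operator_on_def)
  finally show ?thesis .
qed

lemma mult_map_left:
  assumes F: "operator_on B F" and a: "a \<in> B"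
  shows "mult_map B (op_tensor B B F (\<lambda>x. x) (mult_adj B \<psi> a)) = (\<Sum>k<N. F (h k) ** cadj (h k)) ** a"
proof -
  have *: "op_tensor B B F (\<lambda>x. x) (mult_adj B \<psi> a) = (\<Sum>k<N. kron (F (h k)) (cadj (h k) ** a))"
    unfolding mult_adj_eq[OF a]
    by (rule op_tensor_sum_kron[OF F operator_on_id]) (use a h_in in auto)
  show ?thesis
    unfolding * using F a h_in by (subst mult_map_sum_kron) (auto simp: operator_on_def matrix_mult_sum_left matrix_mul_assoc)
qed

lemma mult_map_right:
  assumes F: "operator_on B F" and a: "a \<in> B"
  shows "mult_map B (op_tensor B B (\<lambda>x. x) F (mult_adj B \<psi> a)) = (\<Sum>k<N. h k ** F (cadj (h k) ** a))"
proof -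
  have *: "op_tensor B B (\<lambda>x. x) F (mult_adj B \<psi> a) = (\<Sum>k<N. kron (h k) (F (cadj (h k) ** a)))"
    unfolding mult_adj_eq[OF a]
    by (rule op_tensor_sum_kron[OF operator_on_id F]) (use a h_in in auto)
  show ?thesis
    unfolding * using F a h_in by (subst mult_map_sum_kron) (auto simp: operator_on_def)
qed

text \<open>The KMS property moves \<open>cadj x\<close> past the other factors, so that
  \<open>y\<close> becomes the left entry. The price is conjugation of \<open>cadj x\<close> by
  \<open>R ** R\<close>, that is, by \<open>Q\<close>.\<close>

lemma gns_swap:
  assumes "x \<in> B" "y \<in> B" "a \<in> B"
  shows "gns \<psi> x (cadj y ** a) = gns \<psi> y (a ** (R ** R ** cadj x ** S ** S))"
  using kms[of "cadj x" "cadj y ** a"] assms by (simp add: gns_def matrix_mul_assoc)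

text \<open>Once \<open>F\<close> is expanded in the frame, \<open>gns_swap\<close> turns the sum
  over \<open>k\<close> into the frame expansion of a single element, and it collapses. The modular
  factors left over are the source of \<open>Q\<close> and its inverse around
  \<open>W2\<close>.\<close>

lemma sum_mult_operator_cadj:
  assumes F: "operator_on B F" and a: "a \<in> B"
  shows "(\<Sum>k<N. h k ** F (cadj (h k) ** a)) = a ** R ** R ** (\<Sum>k<N. cadj (h k) ** S ** S ** F (h k))"
proof -
  have FB: "F (h j) \<in> B" if "j < N" for j
    using F h_in that by (simp add: operator_on_def)
  have "(\<Sum>k<N. h k ** F (cadj (h k) ** a)) =
      (\<Sum>k<N. h k ** (\<Sum>j<N. cscale (gns \<psi> (h j) (cadj (h k) ** a)) (F (h j))))"
    using a h_in operator_frame[OF F] by (intro sum.cong refl) simp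
  also have "\<dots> = (\<Sum>k<N. \<Sum>j<N. cscale (gns \<psi> (h j) (cadj (h k) ** a)) (h k) ** F (h j))"
    by (simp add: matrix_mult_sum_right matrix_mult_cscale cscale_matrix_mult)
  also have "\<dots> = (\<Sum>j<N. \<Sum>k<N. cscale (gns \<psi> (h j) (cadj (h k) ** a)) (h k) ** F (h j))"
    by (rule sum.swap)
  also have "\<dots> = (\<Sum>j<N. (a ** (R ** R ** cadj (h j) ** S ** S)) ** F (h j))"
  proof (rule sum.cong[OF refl])
    fix j assume j: "j \<in> {..<N}"
    have "(\<Sum>k<N. cscale (gns \<psi> (h j) (cadj (h k) ** a)) (h k)) =
        (\<Sum>k<N. cscale (gns \<psi> (h k) (a ** (R ** R ** cadj (h j) ** S ** S))) (h k))"
      using j h_in a by (intro sum.cong refl) (simp add: gns_swap)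
    also have "\<dots> = a ** (R ** R ** cadj (h j) ** S ** S)"
      using j h_in a RS_in by (intro frame) simp
    finally show "(\<Sum>k<N. cscale (gns \<psi> (h j) (cadj (h k) ** a)) (h k) ** F (h j)) =
        (a ** (R ** R ** cadj (h j) ** S ** S)) ** F (h j)"
      by (simp flip: matrix_mult_sum_left)
  qed
  also have "\<dots> = a ** R ** R ** (\<Sum>k<N. cadj (h k) ** S ** S ** F (h k))"
    by (simp add: matrix_mult_sum_right matrix_mul_assoc)
  finally show ?thesis .
qed

text \<open>The content is the value of the adjoint of multiplication at the unit. The work lies in
  reassociation: the inner lift has to be balanced in the tensor \<open>X\<close> and the third
  factor \<open>z\<close> before the outer lift can be evaluated.\<close>

lemma cup_left_eq:
  assumes c: "c \<in> B"
  shows "cup_left B \<psi> c = (\<Sum>k<N. kron (h k) (kron (cadj (h k)) c))"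
proof -
  interpret T: tensor_pair "tensor_space B B" B
    using csubspace_tensor_space V by unfold_locales
  have bal: "balanced_on B B (\<lambda>a b. kron a (kron b z))" for z :: "complex ^ 'n ^ 'n"
    by (rule balanced_onI) (simp_all add: kron_simps)
  have add: "kron x (kron y (z + z')) = kron x (kron y z) + kron x (kron y z')"
    and scale: "kron x (kron y (cscale w z)) = cscale w (kron x (kron y z))"
    for x y z z' :: "complex ^ 'n ^ 'n" and w
    by (simp_all add: kron_simps)
  have bal2: "balanced_on (tensor_space B B) B (\<lambda>X z. tlift B B (\<lambda>a b. kron a (kron b z)) X)"
  proof (rule balanced_onI)
    fix X and z z' :: "complex ^ 'n ^ 'n" assume X: "X \<in> tensor_space B B"
    obtain M a b where ab: "\<And>k. k < M \<Longrightarrow> a k \<in> B" "\<And>k. k < M \<Longrightarrow> b k \<in> B"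
      "X = (\<Sum>k<(M::nat). kron (a k) (b k))"
      using tensor_spaceE[OF X] by blast
    have tl: "tlift B B (\<lambda>a b. kron a (kron b z)) X = (\<Sum>k<M. kron (a k) (kron (b k) z))" for z :: "complex ^ 'n ^ 'n"
      unfolding ab(3) by (rule tlift_sum_kron[OF bal]) (use ab in auto)
    then     show "tlift B B (\<lambda>a b. kron a (kron b (z + z'))) X =
        tlift B B (\<lambda>a b. kron a (kron b z)) X + tlift B B (\<lambda>a b. kron a (kron b z')) X"
      by (simp only: tl) (simp add: add sum.distrib)
  next
    fix X and z :: "complex ^ 'n ^ 'n" and w :: complex assume X: "X \<in> tensor_space B B"
    obtain M a b where ab: "\<And>k. k < M \<Longrightarrow> a k \<in> B" "\<And>k. k < M \<Longrightarrow> b k \<in> B"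
      "X = (\<Sum>k<(M::nat). kron (a k) (b k))"
      using tensor_spaceE[OF X] by blast
    have tl: "tlift B B (\<lambda>a b. kron a (kron b z)) X = (\<Sum>k<M. kron (a k) (kron (b k) z))" for z :: "complex ^ 'n ^ 'n"
      unfolding ab(3) by (rule tlift_sum_kron[OF bal]) (use ab in auto)
    have "tlift B B (\<lambda>a b. kron a (kron b z)) (cscale w X) = cscale w (tlift B B (\<lambda>a b. kron a (kron b z)) X)"
      by (rule tlift_cscale[OF bal X]) (simp_all add: kron_simps cscale_add)
    also have "\<dots> = tlift B B (\<lambda>a b. kron a (kron b (cscale w z))) X"
      by (simp only: tl) (simp add: scale cscale_sum)
    finally show "tlift B B (\<lambda>a b. kron a (kron b z)) (cscale w X) =
        tlift B B (\<lambda>a b. kron a (kron b (cscale w z))) X" .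
  qed (simp add: tlift_add[OF bal])
  have m: "mult_adj B \<psi> (unit_map 1) = (\<Sum>k<N. kron (h k) (cadj (h k)))"
    by (simp add: unit_map_def mult_adj_eq)
  have "(\<Sum>k<N. kron (h k) (cadj (h k))) \<in> tensor_space B B"
    using h_in by (intro sum_kron_in_tensor_space) auto
  then have "cup_left B \<psi> c = tlift B B (\<lambda>a b. kron a (kron b c)) (\<Sum>k<N. kron (h k) (cadj (h k)))"
    unfolding cup_left_def assoc_right_def m by (rule T.tlift_kron[OF bal2 _ c])
  also have "\<dots> = (\<Sum>k<N. kron (h k) (kron (cadj (h k)) c))"
    using h_in by (intro tlift_sum_kron[OF bal]) auto
  finally show ?thesis .
qed

text \<open>The cup creates \<open>h k\<close> and \<open>cadj (h k)\<close>; \<open>F\<close> acts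
  on the latter, and the cap contracts the result with \<open>c\<close>, leaving \<open>h k\<close>
  with a scalar coefficient. Each of the three nested lifts has its own balancedness check.\<close>

lemma undirected_eq:
  assumes F: "operator_on B F" and c: "c \<in> B"
  shows "cap_right B \<psi> (op_tensor B (tensor_space B B) (\<lambda>x. x) (op_tensor B B F (\<lambda>x. x)) (cup_left B \<psi> c)) =
    (\<Sum>k<N. cscale (\<psi> (F (cadj (h k)) ** c)) (h k))"
proof -
  interpret T: tensor_pair B "tensor_space B B"
    using csubspace_tensor_space V by unfold_locales
  have FB: "F a \<in> B" if "a \<in> B" for a
    using F that by (simp add: operator_on_def)
  have bal: "balanced_on B B (\<lambda>a b. kron (F a) b)"
    by (rule balanced_kron) (use F in \<open>auto simp: operator_on_def\<close>)
  have bal2: "balanced_on B (tensor_space B B) (\<lambda>a X. kron a (op_tensor B B F (\<lambda>x. x) X))"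
  proof (rule balanced_onI)
    fix a X and w :: complex assume X: "X \<in> tensor_space B B"
    have "op_tensor B B F (\<lambda>x. x) (cscale w X) = cscale w (op_tensor B B F (\<lambda>x. x) X)"
      unfolding op_tensor_def
      by (rule tlift_cscale[OF bal X]) (use F in \<open>simp_all add: kron_simps cscale_add operator_on_def\<close>)
    then show "kron (cscale w a) (op_tensor B B F (\<lambda>x. x) X) = kron a (op_tensor B B F (\<lambda>x. x) (cscale w X))"
      by (simp add: kron_simps)
  qed (simp_all add: kron_simps op_tensor_def tlift_add[OF bal])
  have "op_tensor B (tensor_space B B) (\<lambda>x. x) (op_tensor B B F (\<lambda>x. x)) (cup_left B \<psi> c) =
      (\<Sum>k<N. kron (h k) (op_tensor B B F (\<lambda>x. x) (kron (cadj (h k)) c)))"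
    unfolding cup_left_eq[OF c] op_tensor_def[of B "tensor_space B B"]
    by (rule T.tlift_sum_kron[OF bal2]) (use h_in c kron_in_tensor_space in auto)
  also have "\<dots> = (\<Sum>k<N. kron (h k) (kron (F (cadj (h k))) c))"
  proof (intro sum.cong refl)
    fix k assume "k \<in> {..<N}"
    then show "kron (h k) (op_tensor B B F (\<lambda>x. x) (kron (cadj (h k)) c)) = kron (h k) (kron (F (cadj (h k))) c)"
      unfolding op_tensor_def using h_in c by (subst tlift_kron[OF bal]) auto
  qed
  finally have 1: "op_tensor B (tensor_space B B) (\<lambda>x. x) (op_tensor B B F (\<lambda>x. x)) (cup_left B \<psi> c) =
      (\<Sum>k<N. kron (h k) (kron (F (cadj (h k))) c))" .
  have mB: "mult_map B X \<in> B" if X: "X \<in> tensor_space B B" for X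
  proof -
    obtain M a b where ab: "\<And>k. k < M \<Longrightarrow> a k \<in> B" "\<And>k. k < M \<Longrightarrow> b k \<in> B"
      "X = (\<Sum>k<(M::nat). kron (a k) (b k))"
      using tensor_spaceE[OF X] by blast
    then show ?thesis
      by (auto simp: mult_map_sum_kron intro!: sum_in)
  qed
  have bal3: "balanced_on B (tensor_space B B) (\<lambda>a X. cscale (unit_adj \<psi> (mult_map B X)) a)"
  proof (rule balanced_onI)
    fix a X Y assume "X \<in> tensor_space B B" "Y \<in> tensor_space B B"
    then show "cscale (unit_adj \<psi> (mult_map B (X + Y))) a =
        cscale (unit_adj \<psi> (mult_map B X)) a + cscale (unit_adj \<psi> (mult_map B Y)) a"
      using mB tensor_space_add[of X Y] tlift_add[OF balanced_mult, of X Y]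
      by (simp add: unit_adj_eq mult_map_def \<psi>_add cscale_left_add)
  next
    fix a X and w :: complex assume X: "X \<in> tensor_space B B"
    have wX: "cscale w X \<in> tensor_space B B"
      using X csubspace_tensor_space by (simp add: csubspace_def)
    have "mult_map B (cscale w X) = cscale w (mult_map B X)"
      unfolding mult_map_def by (rule tlift_cscale[OF balanced_mult X]) (simp_all add: cscale_matrix_mult cscale_add)
    then show "cscale (unit_adj \<psi> (mult_map B X)) (cscale w a) = cscale (unit_adj \<psi> (mult_map B (cscale w X))) a"
      using mB[OF X] mB[OF wX] by (simp add: unit_adj_eq \<psi>_cscale mult.commute)
  qed (simp add: cscale_add)
  have "cap_right B \<psi> (\<Sum>k<N. kron (h k) (kron (F (cadj (h k))) c)) =
      (\<Sum>k<N. cscale (unit_adj \<psi> (mult_map B (kron (F (cadj (h k))) c))) (h k))"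
    unfolding cap_right_def
    by (rule T.tlift_sum_kron[OF bal3]) (use h_in c FB kron_in_tensor_space in auto)
  also have "\<dots> = (\<Sum>k<N. cscale (\<psi> (F (cadj (h k)) ** c)) (h k))"
    using h_in c FB by (intro sum.cong refl) (simp add: mult_map_kron unit_adj_eq)
  finally show ?thesis
    unfolding 1 .
qed

text \<open>Inserting the expansion of \<open>F (h j)\<close> supplied by undirectedness, the sum
  over \<open>j\<close> rebuilds \<open>F (cadj (h k))\<close>. What remains is the value at the
  unit of the right-hand contraction, already computed in
  \<open>sum_mult_operator_cadj\<close>.\<close>

lemma undirected_contraction:
  assumes F: "operator_on B F"
    and und: "\<And>c. c \<in> B \<Longrightarrow> (\<Sum>k<N. cscale (\<psi> (F (cadj (h k)) ** c)) (h k)) = F c"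
  shows "(\<Sum>j<N. F (h j) ** cadj (h j)) = R ** R ** (\<Sum>k<N. cadj (h k) ** S ** S ** F (h k))"
proof -
  have FB: "F a \<in> B" if "a \<in> B" for a
    using F that by (simp add: operator_on_def)
  have "(\<Sum>j<N. F (h j) ** cadj (h j)) =
      (\<Sum>j<N. \<Sum>k<N. h k ** cscale (\<psi> (F (cadj (h k)) ** h j)) (cadj (h j)))"
    using h_in by (simp add: matrix_mult_sum_left cscale_matrix_mult matrix_mult_cscale flip: und)
  also have "\<dots> = (\<Sum>k<N. \<Sum>j<N. h k ** cscale (\<psi> (F (cadj (h k)) ** h j)) (cadj (h j)))"
    by (rule sum.swap)
  also have "\<dots> = (\<Sum>k<N. h k ** F (cadj (h k)))"
  proof (rule sum.cong[OF refl])
    fix k assume "k \<in> {..<N}"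
    \<comment> \<open>The coefficient is the inner product of the adjoint of
      \<open>F (cadj (h k))\<close> with \<open>h j\<close>, so this is the adjoint frame expansion
      of that element.\<close>
    then have "(\<Sum>j<N. cscale (\<psi> (F (cadj (h k)) ** h j)) (cadj (h j))) = F (cadj (h k))"
      using frame_cadj[of "cadj (F (cadj (h k)))"] h_in FB by (simp add: gns_def)
    then show "(\<Sum>j<N. h k ** cscale (\<psi> (F (cadj (h k)) ** h j)) (cadj (h j))) = h k ** F (cadj (h k))"
      by (simp flip: matrix_mult_sum_right)
  qed
  also have "\<dots> = R ** R ** (\<Sum>k<N. cadj (h k) ** S ** S ** F (h k))"
    using sum_mult_operator_cadj[OF F, of "mat 1"] by simp
  finally show ?thesis .
qed

text \<open>Expanding each \<open>cadj (a k)\<close> along the frame moves the coefficients into the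
  other factor, where they assemble to \<open>G (F (h j))\<close>. The tensor thus depends on
  \<open>F\<close> alone and not on its decomposition into rank one operators, which makes both
  \<Psi> maps well defined.\<close>

lemma Choi_unique:
  assumes G: "operator_on B G"
    and ab: "\<And>k. k < M \<Longrightarrow> a k \<in> B" "\<And>k. k < M \<Longrightarrow> b k \<in> B"
    and F: "\<And>c. c \<in> B \<Longrightarrow> F c = (\<Sum>k<(M::nat). rank_one \<psi> (a k) (b k) c)"
  shows "(\<Sum>k<M. kron (cadj (a k)) (G (b k))) = (\<Sum>j<N. kron (cadj (h j)) (G (F (h j))))"
    and "(\<Sum>k<M. kron (G (b k)) (cadj (a k))) = (\<Sum>j<N. kron (G (F (h j))) (cadj (h j)))"
proof -
  have a: "cadj (a k) = (\<Sum>j<N. cscale (gns \<psi> (a k) (h j)) (cadj (h j)))" if "k < M" for k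
    using frame_cadj ab that by simp
  have GF: "G (F (h j)) = (\<Sum>k<M. cscale (gns \<psi> (a k) (h j)) (G (b k)))" if "j < N" for j
  proof -
    have "G (F (h j)) = (\<Sum>k<M. G (cscale (gns \<psi> (a k) (h j)) (b k)))"
      using that h_in ab by (simp add: F rank_one_def) (subst operator_on_sum[OF G], auto)
    then show ?thesis
      using G ab by (simp add: operator_on_def)
  qed
  have "(\<Sum>k<M. kron (cadj (a k)) (G (b k))) =
      (\<Sum>k<M. \<Sum>j<N. kron (cadj (h j)) (cscale (gns \<psi> (a k) (h j)) (G (b k))))"
    by (simp add: a kron_sum_left kron_simps)
  also have "\<dots> = (\<Sum>j<N. \<Sum>k<M. kron (cadj (h j)) (cscale (gns \<psi> (a k) (h j)) (G (b k))))"
    by (rule sum.swap)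
  also have "\<dots> = (\<Sum>j<N. kron (cadj (h j)) (G (F (h j))))"
    by (simp add: GF kron_sum_right)
  finally show "(\<Sum>k<M. kron (cadj (a k)) (G (b k))) = (\<Sum>j<N. kron (cadj (h j)) (G (F (h j))))" .
  have "(\<Sum>k<M. kron (G (b k)) (cadj (a k))) =
      (\<Sum>k<M. \<Sum>j<N. kron (cscale (gns \<psi> (a k) (h j)) (G (b k))) (cadj (h j)))"
    by (simp add: a kron_sum_right kron_simps)
  also have "\<dots> = (\<Sum>j<N. \<Sum>k<M. kron (cscale (gns \<psi> (a k) (h j)) (G (b k))) (cadj (h j)))"
    by (rule sum.swap)
  also have "\<dots> = (\<Sum>j<N. kron (G (F (h j))) (cadj (h j)))"
    by (simp add: GF kron_sum_left)
  finally show "(\<Sum>k<M. kron (G (b k)) (cadj (a k))) = (\<Sum>j<N. kron (G (F (h j))) (cadj (h j)))" .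
qed

lemma
  assumes F: "operator_on B F" and mod: "modular Q (\<i> / 2) = (\<lambda>x. S ** x ** R)"
  shows Psi_0_half_eq: "Psi_0_half B \<psi> Q F = (\<Sum>j<N. kron (cadj (h j)) (S ** F (h j) ** R))"
    and Psi'_half_0_eq: "Psi'_half_0 B \<psi> Q F = (\<Sum>j<N. kron (S ** F (h j) ** R) (cadj (h j)))"
proof -
  have G: "operator_on B (\<lambda>x. S ** x ** R)"
    using RS_in by (rule operator_on_two_sided[rotated])
  have frameF: "\<forall>k<N. h k \<in> B \<and> F (h k) \<in> B" "\<forall>c\<in>B. F c = (\<Sum>k<N. rank_one \<psi> (h k) (F (h k)) c)"
    using F h_in operator_frame[OF F] by (auto simp: rank_one_def operator_on_def)
  show "Psi_0_half B \<psi> Q F = (\<Sum>j<N. kron (cadj (h j)) (S ** F (h j) ** R))"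
    unfolding Psi_0_half_def mod
  proof (rule the_equality)
    show "\<exists>(M::nat) a b. (\<forall>k<M. a k \<in> B \<and> b k \<in> B) \<and>
        (\<forall>c\<in>B. F c = (\<Sum>k<M. rank_one \<psi> (a k) (b k) c)) \<and>
        (\<Sum>j<N. kron (cadj (h j)) (S ** F (h j) ** R)) = (\<Sum>k<M. kron (cadj (a k)) (S ** b k ** R))"
      by (intro exI[of _ N] exI[of _ h] exI[of _ "\<lambda>k. F (h k)"] conjI frameF refl)
  next
    fix X assume "\<exists>(M::nat) a b. (\<forall>k<M. a k \<in> B \<and> b k \<in> B) \<and>
        (\<forall>c\<in>B. F c = (\<Sum>k<M. rank_one \<psi> (a k) (b k) c)) \<and>
        X = (\<Sum>k<M. kron (cadj (a k)) (S ** b k ** R))"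
    then obtain M :: nat and a b where "\<forall>k<M. a k \<in> B \<and> b k \<in> B"
      "\<forall>c\<in>B. F c = (\<Sum>k<M. rank_one \<psi> (a k) (b k) c)"
      "X = (\<Sum>k<M. kron (cadj (a k)) (S ** b k ** R))"
      by blast
    with Choi_unique(1)[OF G, of M a b F] show "X = (\<Sum>j<N. kron (cadj (h j)) (S ** F (h j) ** R))"
      by simp
  qed
  show "Psi'_half_0 B \<psi> Q F = (\<Sum>j<N. kron (S ** F (h j) ** R) (cadj (h j)))"
    unfolding Psi'_half_0_def mod
  proof (rule the_equality)
    show "\<exists>(M::nat) a b. (\<forall>k<M. a k \<in> B \<and> b k \<in> B) \<and>
        (\<forall>c\<in>B. F c = (\<Sum>k<M. rank_one \<psi> (a k) (b k) c)) \<and>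
        (\<Sum>j<N. kron (S ** F (h j) ** R) (cadj (h j))) = (\<Sum>k<M. kron (S ** b k ** R) (cadj (a k)))"
      by (intro exI[of _ N] exI[of _ h] exI[of _ "\<lambda>k. F (h k)"] conjI frameF refl)
  next
    fix X assume "\<exists>(M::nat) a b. (\<forall>k<M. a k \<in> B \<and> b k \<in> B) \<and>
        (\<forall>c\<in>B. F c = (\<Sum>k<M. rank_one \<psi> (a k) (b k) c)) \<and>
        X = (\<Sum>k<M. kron (S ** b k ** R) (cadj (a k)))"
    then obtain M :: nat and a b where "\<forall>k<M. a k \<in> B \<and> b k \<in> B"
      "\<forall>c\<in>B. F c = (\<Sum>k<M. rank_one \<psi> (a k) (b k) c)"
      "X = (\<Sum>k<M. kron (S ** b k ** R) (cadj (a k)))"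
      by blast
    with Choi_unique(2)[OF G, of M a b F] show "X = (\<Sum>j<N. kron (S ** F (h j) ** R) (cadj (h j)))"
      by simp
  qed
qed

text \<open>Once \<open>u\<close> is read as the matrix \<open>S\<close>, acting on it inserts
  \<open>S\<close> between the two tensor factors. The modular twist in (4) inserts the same
  \<open>S\<close> and adds an invertible \<open>R\<close> in front, so (2) and (4) agree for every
  tensor of this form. The adjoint action replaces each factor by its adjoint and keeps their
  order.\<close>

lemma action_on_unvec_S:
  assumes xy: "\<And>k. k < M \<Longrightarrow> x k \<in> B" "\<And>k. k < M \<Longrightarrow> y k \<in> B"
    and e: "e = (\<Sum>k<(M::nat). kron (x k) (y k))" and u: "unvec u = S"
  shows "bop_action B e *v u = 0 \<longleftrightarrow> (\<Sum>k<M. x k ** S ** y k) = 0"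
    and "cadj (bop_action B e) *v u = 0 \<longleftrightarrow> (\<Sum>k<M. cadj (x k) ** S ** cadj (y k)) = 0"
    and "mult_map B (op_tensor B B (\<lambda>x. R ** x ** S) (\<lambda>x. x) e) = 0 \<longleftrightarrow> (\<Sum>k<M. x k ** S ** y k) = 0"
proof -
  have act: "bop_action B e = (\<Sum>k<M. kron (x k) (transpose (y k)))"
    unfolding e using xy by (rule bop_action_sum_kron)
  have tr: "cadj (transpose y) = transpose (cadj y)" for y :: "complex ^ 'n ^ 'n"
    by (simp add: vec_eq_iff transpose_def)
  show "bop_action B e *v u = 0 \<longleftrightarrow> (\<Sum>k<M. x k ** S ** y k) = 0"
    by (subst unvec_eq_0_iff[symmetric])
       (simp add: act sum_matrix_vector_mult unvec_sum unvec_kron_transpose u)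
  show "cadj (bop_action B e) *v u = 0 \<longleftrightarrow> (\<Sum>k<M. cadj (x k) ** S ** cadj (y k)) = 0"
    by (subst unvec_eq_0_iff[symmetric])
       (simp add: act cadj_sum cadj_kron tr sum_matrix_vector_mult unvec_sum unvec_kron_transpose u)
  have "op_tensor B B (\<lambda>x. R ** x ** S) (\<lambda>x. x) e = (\<Sum>k<M. kron (R ** x k ** S) (y k))"
    unfolding e by (rule op_tensor_sum_kron[OF operator_on_two_sided operator_on_id]) (use RS_in xy in auto)
  then have "mult_map B (op_tensor B B (\<lambda>x. R ** x ** S) (\<lambda>x. x) e) = R ** (\<Sum>k<M. x k ** S ** y k)"
    using xy RS_in by (subst \<open>op_tensor B B _ _ e = _\<close>, subst mult_map_sum_kron)
      (auto simp: matrix_mult_sum_right matrix_mul_assoc)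
  then show "mult_map B (op_tensor B B (\<lambda>x. R ** x ** S) (\<lambda>x. x) e) = 0 \<longleftrightarrow> (\<Sum>k<M. x k ** S ** y k) = 0"
    by (simp add: mult_left_eq_0_iff)
qed

end

subsection \<open>The equivalence\<close>

text \<open>Since \<open>Tr\<close> is tracial and \<open>Q = R ** R\<close>, the GNS inner product
  of \<open>a\<close> and \<open>b\<close> is the trace inner product of \<open>a ** R\<close> and
  \<open>b ** R\<close>. Right multiplication by \<open>S\<close> therefore carries a frame for the
  trace to one for \<psi>.\<close>

lemma gns_frame_exists:
  fixes B :: "(complex ^ 'n ^ 'n) set"
  assumes B: "unital_star_subalgebra B"
    and Tr: "block_trace B Tr"
    and \<psi>: "linear_on_alg B \<psi>"
    and Q: "Q \<in> B" "pos_def Q" "\<forall>a\<in>B. \<psi> a = Tr (Q ** a)"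
  obtains N h where "gns_frame B \<psi> (cmpow Q (1 / 2)) (cmpow Q (- 1 / 2)) N h"
proof -
  define R S where "R = cmpow Q (1 / 2)" and "S = cmpow Q (- 1 / 2)"
  note Bs [simp] = unital_star_subalgebraD(1-5)[OF B]
  obtain N :: nat and g where g: "\<And>k. k < N \<Longrightarrow> g k \<in> B"
    "\<And>c. c \<in> B \<Longrightarrow> (\<Sum>k<N. cscale (Tr (cadj (g k) ** c)) (g k)) = c"
    using block_trace_frame[OF Tr B] by blast
  have cmpow_in: "cmpow Q w \<in> B" for w
    using cmpow_peval[OF Q(2), of w] peval_in[OF B Q(1)] by metis
  then have RS_in [simp]: "R \<in> B" "S \<in> B"
    by (simp_all add: R_def S_def)
  have RS: "R ** S = mat 1" "S ** R = mat 1" and RR: "R ** R = Q"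
    using cmpow_add[OF Q(2)] cmpow_0[OF Q(2)] cmpow_1[OF Q(2)] by (simp_all add: R_def S_def)
  have cadj_RS: "cadj R = R" "cadj S = S"
    using cadj_cmpow[OF Q(2), of "1 / 2"] cadj_cmpow[OF Q(2), of "- 1 / 2"]
    by (simp_all add: R_def S_def)
  have cancel: "M ** R ** S = M" "M ** S ** R = M" for M
    by (metis RS matrix_mul_assoc matrix_mul_rid)+
  have cadj_Q: "cadj Q = Q"
    using Q(2) by (simp add: pos_def_def)
  have QB [simp]: "Q \<in> B"
    by (rule Q(1))
  have comm: "Tr (a ** b) = Tr (b ** a)" if "a \<in> B" "b \<in> B" for a b
    using block_trace_commute[OF Tr B] that .
  have "gns_frame B \<psi> R S N (\<lambda>k. g k ** S)"
  proof
    fix a b assume ab: "a \<in> B" "b \<in> B"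
    have "cnj (gns \<psi> a b) = Tr (cadj b ** a ** Q)"
      using ab Q(3) block_trace_cadj[OF Tr B, of "Q ** (cadj a ** b)"]
      by (simp add: gns_def cadj_Q)
    also have "\<dots> = gns \<psi> b a"
      using ab Q(3) comm[of "cadj b ** a" Q] by (simp add: gns_def)
    finally show "cnj (gns \<psi> a b) = gns \<psi> b a" .
    have "\<psi> (b ** (R ** R ** a ** S ** S)) = Tr ((Q ** b) ** (Q ** a ** S ** S))"
      using ab Q(3) by (simp add: RR matrix_mul_assoc)
    also have "\<dots> = Tr ((Q ** a ** S ** S) ** (Q ** b))"
      using ab by (intro comm) simp_all
    also have "\<dots> = \<psi> (a ** b)"
      using ab Q(3) by (simp add: matrix_mul_assoc cancel flip: RR)
    finally show "\<psi> (a ** b) = \<psi> (b ** (R ** R ** a ** S ** S))" ..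
  next
    fix c assume c: "c \<in> B"
    have "gns \<psi> (g k ** S) c = Tr (cadj (g k) ** (c ** R))" if "k < N" for k
    proof -
      have "gns \<psi> (g k ** S) c = Tr (R ** (cadj (g k) ** c))"
        using that c g(1) Q(3) by (simp add: gns_def cadj_RS matrix_mul_assoc cancel flip: RR)
      also have "\<dots> = Tr (cadj (g k) ** (c ** R))"
        using that c g(1) by (subst comm) (simp_all add: matrix_mul_assoc)
      finally show ?thesis .
    qed
    then have "(\<Sum>k<N. cscale (gns \<psi> (g k ** S) c) (g k ** S)) =
        (\<Sum>k<N. cscale (Tr (cadj (g k) ** (c ** R))) (g k)) ** S"
      by (simp add: matrix_mult_sum_left cscale_matrix_mult)
    also have "\<dots> = c"
      using g(2)[of "c ** R"] c by (simp add: cancel)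
    finally show "(\<Sum>k<N. cscale (gns \<psi> (g k ** S) c) (g k ** S)) = c" .
  qed (use B \<psi> RS cadj_RS g(1) in auto)
  then show thesis
    unfolding R_def S_def by (rule that)
qed

theorem proposition5p26:
  fixes B :: "(complex ^ 'n ^ 'n) set"
    and Tr \<psi> :: "complex ^ 'n ^ 'n \<Rightarrow> complex"
    and Q :: "complex ^ 'n ^ 'n"
    and A :: "complex ^ 'n ^ 'n \<Rightarrow> complex ^ 'n ^ 'n"
    and e :: "complex ^ ('n \<times> 'n) ^ ('n \<times> 'n)"
    and V :: "(complex ^ ('n \<times> 'n)) set"
    and f :: "'j::finite \<Rightarrow> complex ^ 'n"
    and u0 u1 :: "complex ^ ('n \<times> 'n)"
  assumes B: "unital_star_subalgebra B"
    and Tr: "block_trace B Tr"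
    and \<psi>: "faithful_state B \<psi>"
    and Q: "Q \<in> B" "positive_in B Q" "invertible Q" "\<forall>a\<in>B. \<psi> a = Tr (Q ** a)"
    and A: "operator_on B A"
    and A_selfadjoint: "selfadjoint_on B \<psi> A"
    and A_idempotent: "\<forall>a\<in>B. mult_map B (op_tensor B B A A (mult_adj B \<psi> a)) = A a"
    and A_undirected: "\<forall>a\<in>B. cap_right B \<psi>
          (op_tensor B (tensor_space B B) (\<lambda>x. x) (op_tensor B B A (\<lambda>x. x)) (cup_left B \<psi> a)) = A a"
    and e: "e = Psi_0_half B \<psi> Q A \<or> e = Psi'_half_0 B \<psi> Q A"
    and V: "V = range (\<lambda>v. bop_action B e *v v)"
    and f: "orthonormal_basis f"
    and u0: "u0 = (\<Sum>j\<in>UNIV. vtensor (f j) (vbar (cmpow Q (- 1 / 2) *v f j)))"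
    and u1: "u1 = (\<Sum>j\<in>UNIV. vtensor (cmpow Q (- 1 / 2) *v f j) (vbar (f j)))"
  shows
    "((\<forall>a\<in>B. mult_map B (op_tensor B B A (\<lambda>x. x) (mult_adj B \<psi> a)) = 0) \<longleftrightarrow>
      (\<forall>a\<in>B. mult_map B (op_tensor B B (\<lambda>x. x) A (mult_adj B \<psi> a)) = 0)) \<and>
     (bop_action B e *v u0 = 0 \<longleftrightarrow> bop_action B e *v u1 = 0) \<and>
     ((\<forall>v\<in>V. cinner v u0 = 0) \<longleftrightarrow> (\<forall>v\<in>V. cinner v u1 = 0)) \<and>
     ((\<forall>a\<in>B. mult_map B (op_tensor B B A (\<lambda>x. x) (mult_adj B \<psi> a)) = 0) \<longleftrightarrow>
      bop_action B e *v u0 = 0) \<and>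
     (bop_action B e *v u0 = 0 \<longleftrightarrow> (\<forall>v\<in>V. cinner v u0 = 0)) \<and>
     ((\<forall>v\<in>V. cinner v u0 = 0) \<longleftrightarrow>
      mult_map B (op_tensor B B (modular Q (- \<i> / 2)) (\<lambda>x. x) e) = 0)"
proof -
  note V_range = V
  have pd: "pos_def Q"
    using Q(2,3) pos_defI unfolding positive_in_def by blast
  have lin: "linear_on_alg B \<psi>"
    using \<psi> by (simp add: faithful_state_def)
  obtain N h where "gns_frame B \<psi> (cmpow Q (1 / 2)) (cmpow Q (- 1 / 2)) N h"
    using gns_frame_exists[OF B Tr lin Q(1) pd Q(4)] .
  then interpret gns_frame B \<psi> "cmpow Q (1 / 2)" "cmpow Q (- 1 / 2)" N h .
  define R S where "R = cmpow Q (1 / 2)" and "S = cmpow Q (- 1 / 2)"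
  note RS_folds = R_def[symmetric] S_def[symmetric]
  have i2: "\<i> * (\<i> / 2) = (- 1 / 2 :: complex)" "\<i> * (- \<i> / 2) = (1 / 2 :: complex)"
    by simp_all
  have mod: "modular Q (\<i> / 2) = (\<lambda>x. S ** x ** R)" "modular Q (- \<i> / 2) = (\<lambda>x. R ** x ** S)"
    unfolding modular_def i2 R_def S_def by (simp_all add: fun_eq_iff)
  have cancel: "M ** R ** S = M" "M ** S ** R = M" for M
    using RS unfolding RS_folds by (metis matrix_mul_assoc matrix_mul_rid)+
  note zero_iff = mult_left_eq_0_iff[unfolded RS_folds] mult_right_eq_0_iff[unfolded RS_folds]
  define W1 where "W1 = (\<Sum>k<N. A (h k) ** cadj (h k))"
  define W2 where "W2 = (\<Sum>k<N. cadj (h k) ** S ** S ** A (h k))"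
  have AB: "A (h k) \<in> B" if "k < N" for k
    using A h_in that by (simp add: operator_on_def)
  have "W1 = R ** R ** W2"
    unfolding W1_def W2_def R_def S_def
  proof (rule undirected_contraction[OF A])
    fix c assume c: "c \<in> B"
    show "(\<Sum>k<N. cscale (\<psi> (A (cadj (h k)) ** c)) (h k)) = A c"
      by (rule trans[OF undirected_eq[OF A c, symmetric] A_undirected[rule_format, OF c]])
  qed
  then have W: "W1 = 0 \<longleftrightarrow> W2 = 0"
    by (simp add: zero_iff flip: matrix_mul_assoc)
  have c1: "(\<forall>a\<in>B. mult_map B (op_tensor B B A (\<lambda>x. x) (mult_adj B \<psi> a)) = 0) \<longleftrightarrow> W1 = 0"
  proof
    assume "\<forall>a\<in>B. mult_map B (op_tensor B B A (\<lambda>x. x) (mult_adj B \<psi> a)) = 0"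
    then show "W1 = 0"
      using mult_map_left[OF A B_intros(1)] by (simp add: W1_def)
  qed (simp add: mult_map_left[OF A] flip: W1_def)
  have "mult_map B (op_tensor B B (\<lambda>x. x) A (mult_adj B \<psi> a)) = a ** R ** R ** W2" if "a \<in> B" for a
    using mult_map_right[OF A that] sum_mult_operator_cadj[OF A that] by (simp add: W2_def R_def S_def)
  then have c1': "(\<forall>a\<in>B. mult_map B (op_tensor B B (\<lambda>x. x) A (mult_adj B \<psi> a)) = 0) \<longleftrightarrow> W2 = 0"
    using B_intros(1) by (auto simp: zero_iff simp flip: matrix_mul_assoc dest: bspec[where x = "mat 1"])
  have u: "unvec u0 = S" "unvec u1 = S"
    unfolding u0 u1 unvec_sum_vtensor_right[OF f] unvec_sum_vtensor_left[OF f] cadj_RS S_def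
    by (rule refl)+
  then have u01: "u1 = u0"
    by (simp add: vec_eq_iff)
  have c3: "(\<forall>v\<in>V. cinner v u0 = 0) \<longleftrightarrow> cadj (bop_action B e) *v u0 = 0"
    unfolding V_range by (rule range_orthogonal_iff)
  note u0S = u(1)[unfolded S_def]
  have SAR: "S ** A (h k) ** R \<in> B" if "k < N" for k
    using AB[OF that] RS_in unfolding RS_folds by simp
  have hB: "cadj (h k) \<in> B" if "k < N" for k
    using h_in[OF that] by simp
  from e have c: "(bop_action B e *v u0 = 0 \<longleftrightarrow> W1 = 0) \<and>
      (cadj (bop_action B e) *v u0 = 0 \<longleftrightarrow> W1 = 0) \<and>
      (mult_map B (op_tensor B B (modular Q (- \<i> / 2)) (\<lambda>x. x) e) = 0 \<longleftrightarrow> W1 = 0)"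
  proof
    assume "e = Psi_0_half B \<psi> Q A"
    then have e: "e = (\<Sum>k<N. kron (cadj (h k)) (S ** A (h k) ** R))"
      using Psi_0_half_eq[OF A mod(1)[unfolded R_def S_def]] by (simp add: R_def S_def)
    note act = action_on_unvec_S[OF hB SAR e u0S, unfolded RS_folds]
    \<comment> \<open>The \<open>S\<close> from the vector meets the \<open>S\<close> from the
      modular twist, and together they form the inverse of \<open>Q\<close> inside
      \<open>W2\<close>. Under the adjoint the twist is reversed: its \<open>R\<close> cancels the
      \<open>S\<close> of the vector, which leaves \<open>W1\<close>.\<close>
    have "(\<Sum>k<N. cadj (h k) ** S ** (S ** A (h k) ** R)) = W2 ** R"
      by (simp add: W2_def matrix_mult_sum_left matrix_mul_assoc)
    moreover have "(\<Sum>k<N. cadj (cadj (h k)) ** S ** cadj (S ** A (h k) ** R)) = cadj W1 ** S"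
      using cadj_RS[unfolded RS_folds]
      by (simp add: W1_def cadj_sum matrix_mult_sum_left matrix_mul_assoc cancel)
    ultimately show ?thesis
      unfolding mod using act W by (simp add: zero_iff)
  next
    assume "e = Psi'_half_0 B \<psi> Q A"
    then have e: "e = (\<Sum>k<N. kron (S ** A (h k) ** R) (cadj (h k)))"
      using Psi'_half_0_eq[OF A mod(1)[unfolded R_def S_def]] by (simp add: R_def S_def)
    note act = action_on_unvec_S[OF SAR hB e u0S, unfolded RS_folds]
    \<comment> \<open>With the tensor factors exchanged, the cancellation of \<open>R\<close>
      against \<open>S\<close> happens for \<open>e\<close> itself, and the doubled \<open>S\<close>
      appears for its adjoint.\<close>
    have "(\<Sum>k<N. S ** A (h k) ** R ** S ** cadj (h k)) = S ** W1"
      by (simp add: W1_def matrix_mult_sum_right matrix_mul_assoc cancel)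
    moreover have "(\<Sum>k<N. cadj (S ** A (h k) ** R) ** S ** cadj (cadj (h k))) = R ** cadj W2"
      using cadj_RS[unfolded RS_folds]
      by (simp add: W2_def cadj_sum matrix_mult_sum_right matrix_mul_assoc)
    ultimately show ?thesis
      unfolding mod using act W by (simp add: zero_iff)
  qed
  show ?thesis
    unfolding c1 c1' c3 u01 using c W by blast
qed

end
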